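(* Let $d\ge2$ be an integer, let $\ell\in\mathcal O_d$ satisfy $S_\infty(d,\ell)\ne0$ (definitions in the context), $\gamma=1+2/\ell$, and let $r=r_n<r_\circ(d,\ell)$, $r_n\to r_\circ(d,\ell)$, be the speeds for which the stationary self-similar Euler system has a global $\mathcal C^\infty$ spherically symmetric solution $(\hat\rho,\hat u)$, $\hat\rho>0$, terminating at $P_4$ (i.e. with Emden variables $(\sigma,w)\to(0,0)$ as $|Z|\to+\infty$). Then the compressible Euler equations $$\partial_t\rho+\nabla\cdot(\rho u)=0,\qquad \rho\,\partial_tu+\rho u\cdot\nabla u+\nabla p=0,\qquad p=\frac{\gamma-1}{\gamma}\rho^\gamma,\qquad \rho>0,\qquad y\in\mathbb R^d,$$ admit a family of spherically symmetric self-similar solutions, smooth away from the concentration point $(T,0)$, of the form $$\rho(t,y)=\frac{1}{(T-t)^{\frac{2(r-1)}{r(\gamma-1)}}}\hat\rho(Z),\qquad u(t,y)=\frac{1}{(T-t)^{\frac{r-1}{r}}}\hat u(Z),\qquad Z=\frac{y}{\lambda_0(T-t)^{1/r}},$$ for a suitable constant $\lambda_0>0$, with the asymptotics (as $|Z|\to+\infty$; for $u$ this refers to its radial component) $$\rho(t,y)=\frac{\rho_*\,(1+o_{|Z|\to+\infty}(1))}{|y|^{\frac{2(r-1)}{\gamma-1}}},\qquad u(t,y)=\frac{u_*+o_{|Z|\to+\infty}(1)}{|y|^{r-1}},$$ for some $\rho_*>0$ and $u_*\in\mathbb R$. In particular, these solutions decay at spatial infinity but do not have finite energy.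
   Context: **Stationary self-similar Euler system** (with $\gamma=1+2/\ell$, $r>1$): $\ell(r-1)\hat\rho+Z\cdot\nabla\hat\rho+\nabla\cdot(\hat\rho\,\hat u)=0$, $(r-1)\hat u+(Z\cdot\nabla)\hat u+\hat u\cdot\nabla\hat u+\nabla(\hat\rho^{\,\gamma-1})=0$, $Z\in\mathbb R^d$. The energy of $(\rho,u)$ is $\int_{\mathbb R^d}\left(\frac12\rho|u|^2+\frac{1}{\gamma}\rho^\gamma\right)dy$. **Basic notation.** Spherically symmetric means $\hat\rho=\hat\rho(|Z|)$ and $\hat u$ is radial. The Emden variables $(\sigma,w)$ of $(\hat\rho,\hat u)$ are defined by $\hat\rho(Z)^{\frac{\gamma-1}{2}}=\sqrt{\ell/2}\,|Z|\sigma(x)$, $\hat u(Z)=-Z\,w(x)$, $|Z|=e^x$. They transform the stationary system into $\Delta w'=-\Delta_1$, $\Delta\sigma'=-\Delta_2$ ($'=d/dx$), where $w_e=\ell(r-1)/d$ and $\Delta=(w-1)^2-\sigma^2$, $\Delta_1=w(w-1)(w-r)-d(w-w_e)\sigma^2$, $\Delta_2=\frac{\sigma}{\ell}\left[(\ell+d-1)w^2-(\ell+d+\ell r-r)w+\ell r-\ell\sigma^2\right]$. Points are written $(\sigma,w)$; $P_4=(0,0)$. Critical speeds: $r^*(d,\ell)=\frac{d+\ell}{\ell+\sqrt d}$, $r_+(d,\ell)=1+\frac{d-1}{(1+\sqrt\ell)^2}$; $r_\circ=r^*$ if $0<\ell<d$, $r_\circ=r_+$ if $\ell>d$. For $1<r\le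 r_+$ let $w_\pm=\frac{1}{2(d-1)}\left(d-1+(\ell-1)(r-1)\pm\sqrt J\right)$ with $J=(1-\ell)^2(r-1)^2-2(d-1)(\ell+1)(r-1)+(d-1)^2\ge 0$, and $P_2=(\sigma_2,w_2)=(1-w_-,w_-)$. **Linear data at $P_2$.** $c_1=\partial_w\Delta_1(P_2)$, $c_2=\partial_w\Delta_2(P_2)$, $c_3=\partial_\sigma\Delta_1(P_2)$, $c_4=\partial_\sigma\Delta_2(P_2)$, $c_\pm=\frac{c_4-c_1\pm\sqrt{(c_1-c_4)^2+4c_2c_3}}{2|c_2|}$, $\lambda_\pm=\frac{c_1+c_4\pm\sqrt{(c_1-c_4)^2+4c_2c_3}}{2}$. For $r<r_\circ$ put $b=r^*-r$ if $\ell<d$, $b=\sqrt{r_+-r}$ if $\ell>d$. **Limiting coefficients (all evaluated at $r=r_\circ$, $\ell\ne d$).** At $r=r_\circ$ one has $\lambda_+=0$, $\lambda_-<0$; let $\mu_+=\lim_{r\uparrow r_\circ}\lambda_+(r)/b<0$. Let $\tilde d_{ij}$ (resp. $\tilde e_{ij}$) be the coefficient of $\tilde W^i\tilde\Sigma^j$ in the polynomial $-\Delta_1+c_+\Delta_2$ (resp. $\Delta_1-c_-\Delta_2$) evaluated at $w=w_2+c_-\tilde W+c_+\tilde\Sigma$, $\sigma=\sigma_2+\tilde W+\tilde\Sigma$ (one has $\tilde d_{20}<0$, $\tilde e_{20}>0$). Put $$\hat w=\frac{(c_+-c_-)\mu_+}{\tilde d_{20}},\quad \hat\psi=-\frac{\tilde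 e_{20}\mu_+}{\tilde d_{20}\lambda_-},\quad a=\frac{|\lambda_-|}{|\mu_+|},$$ $$D_{ij}=\frac{\tilde d_{ij}\,\hat\psi^{\,j}\,\hat w^{\,i+j-1}}{|\mu_+|(c_+-c_-)},\qquad E_{ij}=\frac{\tilde e_{ij}\,\hat\psi^{\,j-1}\,\hat w^{\,i+j-1}}{|\lambda_-|(c_+-c_-)},\qquad \nu_\infty=a\,(E_{11}-D_{11}-D_{30}).$$ **The set $\mathcal O_d$.** $\mathcal O_d=(d,+\infty)\cup\{\ell\in(0,d):\nu_\infty(d,\ell)>0\}$ (for $\ell>d$ one always has $\nu_\infty>0$). **The function $S_\infty$.** Define $H_1(x)=-(E_{11}+E_{30})+(E_{02}+E_{21})x-E_{12}x^2+E_{03}x^3$, $H_2(x)=(D_{11}+D_{30})x-(D_{02}+D_{21})x^2+D_{12}x^3-D_{03}x^4$, $G_1(x)=E_{11}x-(2E_{02}+E_{21})x^2+2E_{12}x^3-3E_{03}x^4$, $G_2(x)=-D_{11}x+(2D_{02}+D_{21})x^2-2D_{12}x^3+3D_{03}x^4$, $N_1(x,\Psi)=-xM_{11}\Psi^2+x^2M_{12}\Psi^3$ with $M_{11}=-E_{02}x+E_{12}x^2-3E_{03}x^3$, $M_{12}=-E_{03}x^2$, $N_2(x,\Psi)=-xM_{21}\Psi^2+x^2M_{22}\Psi^3$ with $M_{21}=D_{02}x-D_{12}x^2+3D_{03}x^3$, $M_{22}=D_{03}x^2$. Let $\tilde\Psi$ be the unique local $\mathcal C^\infty$ solution on some $[0,x_0]$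 (its Taylor coefficients at $0$ are determined recursively, and $\tilde\Psi(0)=0$) of $$[1+H_2+G_2\tilde\Psi+N_2](-x^2)\tilde\Psi'+\left[-2x(1+H_2+G_2\tilde\Psi+N_2)-a(1+G_1)+2xG_2\right]\tilde\Psi=x\left[aH_1-2(1+H_2)+\frac{aN_1}{x}-2N_2\right].$$ Let $\xi(x)=\frac{a(1+G_1)-2xG_2}{x^2(1+H_2)}-\frac a{x^2}-\frac{\nu_\infty}{x}$ (holomorphic near $0$), $M(x)=e^{-\int_0^x\xi}$, $\Theta(x)=\frac{\tilde\Psi(x)}{xM(x)}$, and let $(g_j^\infty)_{j\ge0}$ be the Taylor coefficients at $x=0$ of $x^2\Theta'+[a+(\nu_\infty+3)x]\Theta$. Then $S_\infty(d,\ell)=\frac1a\sum_{j=0}^{+\infty}\frac{(-1)^ja^jg_j^\infty}{\Gamma(\nu_\infty+j+3)}$, an absolutely convergent series for $\ell\in\mathcal O_d$. *)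

theory Defs
  imports "HOL-Analysis.Analysis" "HOL-Computational_Algebra.Polynomial"
begin

subsection \<open>Smooth functions, differential operators, spherical symmetry\<close>

text \<open>
  Derivatives are taken within \<open>S\<close>. On an open set this is the usual notion; on a set such as
  a closed half-space minus a point it means smoothness up to the boundary.
\<close>

primrec Ck_on ::
    "nat \<Rightarrow> 'a::euclidean_space set \<Rightarrow> ('a \<Rightarrow> 'b::real_normed_vector) \<Rightarrow> bool" where
  "Ck_on 0 S f \<longleftrightarrow> continuous_on S f"
| "Ck_on (Suc k) S f \<longleftrightarrow>
     (\<exists>D. (\<forall>x\<in>S. (f has_derivative D x) (at x within S)) \<and> (\<forall>v. Ck_on k S (\<lambda>x. D x v)))"

definition smooth_on :: "'a::euclidean_space set \<Rightarrow> ('a \<Rightarrow> 'b::real_normed_vector) \<Rightarrow> bool" where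
  "smooth_on S f \<longleftrightarrow> (\<forall>k. Ck_on k S f)"

definition grad :: "('a::euclidean_space \<Rightarrow> real) \<Rightarrow> 'a \<Rightarrow> 'a" where
  "grad f x = (\<Sum>b\<in>Basis. frechet_derivative f (at x) b *\<^sub>R b)"

definition divergence :: "('a::euclidean_space \<Rightarrow> 'a) \<Rightarrow> 'a \<Rightarrow> real" where
  "divergence F x = (\<Sum>b\<in>Basis. frechet_derivative F (at x) b \<bullet> b)"

definition dir_deriv ::
    "'a::euclidean_space \<Rightarrow> ('a \<Rightarrow> 'b::real_normed_vector) \<Rightarrow> 'a \<Rightarrow> 'b" where
  "dir_deriv v f x = frechet_derivative f (at x) v"

definition spherically_symmetric ::
    "('a::euclidean_space \<Rightarrow> real) \<Rightarrow> ('a \<Rightarrow> 'a) \<Rightarrow> bool" where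
  "spherically_symmetric \<rho> u \<longleftrightarrow>
     (\<exists>f. \<forall>x. \<rho> x = f (norm x)) \<and> (\<exists>g. \<forall>x. u x = g (norm x) *\<^sub>R x)"


subsection \<open>The compressible Euler equations and their self-similar reduction\<close>

definition pressure :: "real \<Rightarrow> real \<Rightarrow> real" where
  "pressure \<gamma> \<rho> = (\<gamma> - 1) / \<gamma> * \<rho> powr \<gamma>"

definition euler_solution ::
    "real \<Rightarrow> real \<Rightarrow> (real \<times> 'a::euclidean_space \<Rightarrow> real) \<Rightarrow> (real \<times> 'a \<Rightarrow> 'a) \<Rightarrow> bool" where
  "euler_solution \<gamma> T \<rho> u \<longleftrightarrow> (\<forall>t<T. \<forall>y.
     \<rho> (t, y) > 0 \<and>
     vector_derivative (\<lambda>s. \<rho> (s, y)) (at t)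
       + divergence (\<lambda>z. \<rho> (t, z) *\<^sub>R u (t, z)) y = 0 \<and>
     \<rho> (t, y) *\<^sub>R vector_derivative (\<lambda>s. u (s, y)) (at t)
       + \<rho> (t, y) *\<^sub>R dir_deriv (u (t, y)) (\<lambda>z. u (t, z)) y
       + grad (\<lambda>z. pressure \<gamma> (\<rho> (t, z))) y = 0)"

definition energy :: "real \<Rightarrow> ('a::euclidean_space \<Rightarrow> real) \<Rightarrow> ('a \<Rightarrow> 'a) \<Rightarrow> ennreal" where
  "energy \<gamma> \<rho> u =
     (\<integral>\<^sup>+ y. ennreal (1 / 2 * \<rho> y * (norm (u y))\<^sup>2 + 1 / \<gamma> * \<rho> y powr \<gamma>) \<partial>lborel)"

definition stationary_euler ::
    "real \<Rightarrow> real \<Rightarrow> real \<Rightarrow> ('a::euclidean_space \<Rightarrow> real) \<Rightarrow> ('a \<Rightarrow> 'a) \<Rightarrow> bool" where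
  "stationary_euler \<gamma> l r \<rho> u \<longleftrightarrow> (\<forall>Z.
     l * (r - 1) * \<rho> Z + dir_deriv Z \<rho> Z + divergence (\<lambda>z. \<rho> z *\<^sub>R u z) Z = 0 \<and>
     (r - 1) *\<^sub>R u Z + dir_deriv Z u Z + dir_deriv (u Z) u Z
       + grad (\<lambda>z. \<rho> z powr (\<gamma> - 1)) Z = 0)"

definition emden_variables ::
    "real \<Rightarrow> real \<Rightarrow> ('a::euclidean_space \<Rightarrow> real) \<Rightarrow> ('a \<Rightarrow> 'a)
      \<Rightarrow> (real \<Rightarrow> real) \<Rightarrow> (real \<Rightarrow> real) \<Rightarrow> bool" where
  "emden_variables \<gamma> l \<rho> u \<sigma> w \<longleftrightarrow> (\<forall>Z. Z \<noteq> 0 \<longrightarrow>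
     \<rho> Z powr ((\<gamma> - 1) / 2) = sqrt (l / 2) * norm Z * \<sigma> (ln (norm Z)) \<and>
     u Z = - (w (ln (norm Z)) *\<^sub>R Z))"

definition terminates_at_P4 ::
    "real \<Rightarrow> real \<Rightarrow> ('a::euclidean_space \<Rightarrow> real) \<Rightarrow> ('a \<Rightarrow> 'a) \<Rightarrow> bool" where
  "terminates_at_P4 \<gamma> l \<rho> u \<longleftrightarrow>
     (\<exists>\<sigma> w. emden_variables \<gamma> l \<rho> u \<sigma> w \<and> (\<sigma> \<longlongrightarrow> 0) at_top \<and> (w \<longlongrightarrow> 0) at_top)"

definition global_smooth_profile ::
    "real \<Rightarrow> real \<Rightarrow> real \<Rightarrow> ('a::euclidean_space \<Rightarrow> real) \<Rightarrow> ('a \<Rightarrow> 'a) \<Rightarrow> bool" where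
  "global_smooth_profile \<gamma> l r \<rho> u \<longleftrightarrow>
     smooth_on UNIV \<rho> \<and> smooth_on UNIV u \<and> (\<forall>Z. \<rho> Z > 0) \<and>
     spherically_symmetric \<rho> u \<and>
     stationary_euler \<gamma> l r \<rho> u \<and> terminates_at_P4 \<gamma> l \<rho> u"

definition selfsim_var :: "real \<Rightarrow> real \<Rightarrow> real \<Rightarrow> real \<times> 'a::real_vector \<Rightarrow> 'a" where
  "selfsim_var lam0 T r = (\<lambda>(t, y). (1 / (lam0 * (T - t) powr (1 / r))) *\<^sub>R y)"


subsection \<open>The autonomous system in Emden variables and its critical speeds\<close>

definition w_e :: "real \<Rightarrow> real \<Rightarrow> real \<Rightarrow> real" where
  "w_e d l r = l * (r - 1) / d"

definition Delta1 :: "real \<Rightarrow> real \<Rightarrow> real \<Rightarrow> real \<Rightarrow> real \<Rightarrow> real" where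
  "Delta1 d l r \<sigma> w = w * (w - 1) * (w - r) - d * (w - w_e d l r) * \<sigma>\<^sup>2"

definition Delta2 :: "real \<Rightarrow> real \<Rightarrow> real \<Rightarrow> real \<Rightarrow> real \<Rightarrow> real" where
  "Delta2 d l r \<sigma> w =
     \<sigma> / l * ((l + d - 1) * w\<^sup>2 - (l + d + l * r - r) * w + l * r - l * \<sigma>\<^sup>2)"

definition r_star :: "real \<Rightarrow> real \<Rightarrow> real" where
  "r_star d l = (d + l) / (l + sqrt d)"

definition r_plus :: "real \<Rightarrow> real \<Rightarrow> real" where
  "r_plus d l = 1 + (d - 1) / (1 + sqrt l)\<^sup>2"

text \<open>Only meant for \<open>l \<noteq> d\<close>.\<close>

definition r_circ :: "real \<Rightarrow> real \<Rightarrow> real" where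
  "r_circ d l = (if l < d then r_star d l else r_plus d l)"

definition J_disc :: "real \<Rightarrow> real \<Rightarrow> real \<Rightarrow> real" where
  "J_disc d l r =
     (1 - l)\<^sup>2 * (r - 1)\<^sup>2 - 2 * (d - 1) * (l + 1) * (r - 1) + (d - 1)\<^sup>2"

definition w2 :: "real \<Rightarrow> real \<Rightarrow> real \<Rightarrow> real" where
  "w2 d l r = 1 / (2 * (d - 1)) * (d - 1 + (l - 1) * (r - 1) - sqrt (J_disc d l r))"

definition \<sigma>2 :: "real \<Rightarrow> real \<Rightarrow> real \<Rightarrow> real" where
  "\<sigma>2 d l r = 1 - w2 d l r"


subsection \<open>Linear data at \<open>P\<^sub>2\<close>\<close>

definition c1 :: "real \<Rightarrow> real \<Rightarrow> real \<Rightarrow> real" where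
  "c1 d l r = deriv (\<lambda>w. Delta1 d l r (\<sigma>2 d l r) w) (w2 d l r)"

definition c2 :: "real \<Rightarrow> real \<Rightarrow> real \<Rightarrow> real" where
  "c2 d l r = deriv (\<lambda>w. Delta2 d l r (\<sigma>2 d l r) w) (w2 d l r)"

definition c3 :: "real \<Rightarrow> real \<Rightarrow> real \<Rightarrow> real" where
  "c3 d l r = deriv (\<lambda>\<sigma>. Delta1 d l r \<sigma> (w2 d l r)) (\<sigma>2 d l r)"

definition c4 :: "real \<Rightarrow> real \<Rightarrow> real \<Rightarrow> real" where
  "c4 d l r = deriv (\<lambda>\<sigma>. Delta2 d l r \<sigma> (w2 d l r)) (\<sigma>2 d l r)"

definition c_disc :: "real \<Rightarrow> real \<Rightarrow> real \<Rightarrow> real" where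
  "c_disc d l r = (c1 d l r - c4 d l r)\<^sup>2 + 4 * c2 d l r * c3 d l r"

definition c_plus :: "real \<Rightarrow> real \<Rightarrow> real \<Rightarrow> real" where
  "c_plus d l r = (c4 d l r - c1 d l r + sqrt (c_disc d l r)) / (2 * \<bar>c2 d l r\<bar>)"

definition c_minus :: "real \<Rightarrow> real \<Rightarrow> real \<Rightarrow> real" where
  "c_minus d l r = (c4 d l r - c1 d l r - sqrt (c_disc d l r)) / (2 * \<bar>c2 d l r\<bar>)"

definition lam_plus :: "real \<Rightarrow> real \<Rightarrow> real \<Rightarrow> real" where
  "lam_plus d l r = (c1 d l r + c4 d l r + sqrt (c_disc d l r)) / 2"

definition lam_minus :: "real \<Rightarrow> real \<Rightarrow> real \<Rightarrow> real" where
  "lam_minus d l r = (c1 d l r + c4 d l r - sqrt (c_disc d l r)) / 2"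

definition b_par :: "real \<Rightarrow> real \<Rightarrow> real \<Rightarrow> real" where
  "b_par d l r = (if l < d then r_star d l - r else sqrt (r_plus d l - r))"


subsection \<open>Limiting coefficients at the critical speed\<close>

definition mu_plus :: "real \<Rightarrow> real \<Rightarrow> real" where
  "mu_plus d l = Lim (at_left (r_circ d l)) (\<lambda>r. lam_plus d l r / b_par d l r)"

text \<open>\<open>coeff2 P i j\<close> is the coefficient of \<open>x\<^sup>i y\<^sup>j\<close> in the polynomial function \<open>P x y\<close>.\<close>

definition coeff2 :: "(real \<Rightarrow> real \<Rightarrow> real) \<Rightarrow> nat \<Rightarrow> nat \<Rightarrow> real" where
  "coeff2 P i j =
     coeff (coeff (THE p :: real poly poly. \<forall>x y. poly (poly p [:y:]) x = P x y) j) i"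

definition d_tilde :: "real \<Rightarrow> real \<Rightarrow> nat \<Rightarrow> nat \<Rightarrow> real" where
  "d_tilde d l = (let r = r_circ d l; cp = c_plus d l r; cm = c_minus d l r in
     coeff2 (\<lambda>W S. let w = w2 d l r + cm * W + cp * S; \<sigma> = \<sigma>2 d l r + W + S
                    in - Delta1 d l r \<sigma> w + cp * Delta2 d l r \<sigma> w))"

definition e_tilde :: "real \<Rightarrow> real \<Rightarrow> nat \<Rightarrow> nat \<Rightarrow> real" where
  "e_tilde d l = (let r = r_circ d l; cp = c_plus d l r; cm = c_minus d l r in
     coeff2 (\<lambda>W S. let w = w2 d l r + cm * W + cp * S; \<sigma> = \<sigma>2 d l r + W + S
                    in Delta1 d l r \<sigma> w - cm * Delta2 d l r \<sigma> w))"

definition c_gap :: "real \<Rightarrow> real \<Rightarrow> real" where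
  "c_gap d l = c_plus d l (r_circ d l) - c_minus d l (r_circ d l)"

definition lam_inf :: "real \<Rightarrow> real \<Rightarrow> real" where
  "lam_inf d l = lam_minus d l (r_circ d l)"

definition w_hat :: "real \<Rightarrow> real \<Rightarrow> real" where
  "w_hat d l = c_gap d l * mu_plus d l / d_tilde d l 2 0"

definition psi_hat :: "real \<Rightarrow> real \<Rightarrow> real" where
  "psi_hat d l = - (e_tilde d l 2 0 * mu_plus d l) / (d_tilde d l 2 0 * lam_inf d l)"

definition a_inf :: "real \<Rightarrow> real \<Rightarrow> real" where
  "a_inf d l = \<bar>lam_inf d l\<bar> / \<bar>mu_plus d l\<bar>"

definition D_coef :: "real \<Rightarrow> real \<Rightarrow> nat \<Rightarrow> nat \<Rightarrow> real" where
  "D_coef d l i j = d_tilde d l i j * psi_hat d l ^ j * w_hat d l powi (int i + int j - 1)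
                       / (\<bar>mu_plus d l\<bar> * c_gap d l)"

definition E_coef :: "real \<Rightarrow> real \<Rightarrow> nat \<Rightarrow> nat \<Rightarrow> real" where
  "E_coef d l i j = e_tilde d l i j * psi_hat d l powi (int j - 1)
                       * w_hat d l powi (int i + int j - 1)
                       / (\<bar>lam_inf d l\<bar> * c_gap d l)"

definition nu_inf :: "real \<Rightarrow> real \<Rightarrow> real" where
  "nu_inf d l = a_inf d l * (E_coef d l 1 1 - D_coef d l 1 1 - D_coef d l 3 0)"

definition O_set :: "real \<Rightarrow> real set" where
  "O_set d = {d<..} \<union> {l \<in> {0<..<d}. nu_inf d l > 0}"


subsection \<open>The function \<open>S\<^sub>\<infinity>\<close>\<close>

definition H1 :: "real \<Rightarrow> real \<Rightarrow> real \<Rightarrow> real" where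
  "H1 d l x = (let E = E_coef d l in
     - (E 1 1 + E 3 0) + (E 0 2 + E 2 1) * x - E 1 2 * x^2 + E 0 3 * x^3)"

definition H2 :: "real \<Rightarrow> real \<Rightarrow> real \<Rightarrow> real" where
  "H2 d l x = (let D = D_coef d l in
     (D 1 1 + D 3 0) * x - (D 0 2 + D 2 1) * x^2 + D 1 2 * x^3 - D 0 3 * x^4)"

definition G1 :: "real \<Rightarrow> real \<Rightarrow> real \<Rightarrow> real" where
  "G1 d l x = (let E = E_coef d l in
     E 1 1 * x - (2 * E 0 2 + E 2 1) * x^2 + 2 * E 1 2 * x^3 - 3 * E 0 3 * x^4)"

definition G2 :: "real \<Rightarrow> real \<Rightarrow> real \<Rightarrow> real" where
  "G2 d l x = (let D = D_coef d l in
     - D 1 1 * x + (2 * D 0 2 + D 2 1) * x^2 - 2 * D 1 2 * x^3 + 3 * D 0 3 * x^4)"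

definition N1 :: "real \<Rightarrow> real \<Rightarrow> real \<Rightarrow> real \<Rightarrow> real" where
  "N1 d l x \<Psi> = (let E = E_coef d l;
       M11 = - E 0 2 * x + E 1 2 * x^2 - 3 * E 0 3 * x^3;
       M12 = - E 0 3 * x^2
     in - x * M11 * \<Psi>^2 + x^2 * M12 * \<Psi>^3)"

definition N2 :: "real \<Rightarrow> real \<Rightarrow> real \<Rightarrow> real \<Rightarrow> real" where
  "N2 d l x \<Psi> = (let D = D_coef d l;
       M21 = D 0 2 * x - D 1 2 * x^2 + 3 * D 0 3 * x^3;
       M22 = D 0 3 * x^2
     in - x * M21 * \<Psi>^2 + x^2 * M22 * \<Psi>^3)"

text \<open>\<open>F k\<close> is the \<open>k\<close>-th derivative of \<open>f\<close> on \<open>I\<close>, one-sided at the endpoints of an interval.\<close>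

definition derivative_sequence ::
    "real set \<Rightarrow> (real \<Rightarrow> real) \<Rightarrow> (nat \<Rightarrow> real \<Rightarrow> real) \<Rightarrow> bool" where
  "derivative_sequence I f F \<longleftrightarrow>
     (\<forall>x\<in>I. F 0 x = f x) \<and>
     (\<forall>k. \<forall>x\<in>I. (F k has_real_derivative F (Suc k) x) (at x within I))"

definition psi_ode :: "real \<Rightarrow> real \<Rightarrow> real \<Rightarrow> real \<Rightarrow> real \<Rightarrow> bool" where
  "psi_ode d l x \<Psi> \<Psi>' \<longleftrightarrow>
     (let a = a_inf d l;
          Q = 1 + H2 d l x + G2 d l x * \<Psi> + N2 d l x \<Psi>
      in Q * (- (x^2)) * \<Psi>'
           + (- 2 * x * Q - a * (1 + G1 d l x) + 2 * x * G2 d l x) * \<Psi>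
         = x * (a * H1 d l x - 2 * (1 + H2 d l x) + a * N1 d l x \<Psi> / x - 2 * N2 d l x \<Psi>))"

definition psi_solution :: "real \<Rightarrow> real \<Rightarrow> real \<Rightarrow> (real \<Rightarrow> real) \<Rightarrow> bool" where
  "psi_solution d l x0 \<Psi> \<longleftrightarrow> \<Psi> 0 = 0 \<and>
     (\<exists>F. derivative_sequence {0..x0} \<Psi> F \<and> (\<forall>x\<in>{0..x0}. psi_ode d l x (\<Psi> x) (F 1 x)))"

text \<open>The singularity of \<open>\<xi>\<close> at \<open>0\<close> is removable; its value there does not affect the integral below.\<close>

definition xi :: "real \<Rightarrow> real \<Rightarrow> real \<Rightarrow> real" where
  "xi d l x =
     (a_inf d l * (1 + G1 d l x) - 2 * x * G2 d l x) / (x^2 * (1 + H2 d l x))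
       - a_inf d l / x^2 - nu_inf d l / x"

definition M_weight :: "real \<Rightarrow> real \<Rightarrow> real \<Rightarrow> real" where
  "M_weight d l x = exp (- integral {0..x} (xi d l))"

text \<open>
  \<open>\<Theta>\<close> is the smooth extension to \<open>x = 0\<close> of \<open>\<Psi> x / (x M x)\<close>, with derivatives \<open>\<Theta>s\<close>; \<open>H\<close> lists the
  derivatives of \<open>x\<^sup>2 \<Theta>' + (a + (\<nu>\<^sub>\<infinity> + 3) x) \<Theta>\<close>. The germ at \<open>0\<close> of the solution \<open>\<Psi>\<close> is unique, so
  the coefficients do not depend on the choice of \<open>x0\<close>.
\<close>

definition g_inf :: "real \<Rightarrow> real \<Rightarrow> nat \<Rightarrow> real" where
  "g_inf d l = (THE g. \<exists>x0 \<Psi> \<Theta> \<Theta>s H. x0 > 0 \<and> psi_solution d l x0 \<Psi> \<and>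
     (\<forall>x\<in>{0<..x0}. \<Theta> x = \<Psi> x / (x * M_weight d l x)) \<and>
     derivative_sequence {0..x0} \<Theta> \<Theta>s \<and>
     derivative_sequence {0..x0}
       (\<lambda>x. x^2 * \<Theta>s 1 x + (a_inf d l + (nu_inf d l + 3) * x) * \<Theta> x) H \<and>
     (\<forall>j. g j = H j 0 / fact j))"

definition S_inf :: "real \<Rightarrow> real \<Rightarrow> real" where
  "S_inf d l = 1 / a_inf d l *
     (\<Sum>j. (-1) ^ j * a_inf d l ^ j * g_inf d l j / Gamma (nu_inf d l + real j + 3))"

end

theory Submission
  imports Defs
begin

text \<open>
  A spherically symmetric profile is governed by the planar Emden system, and the only thing left to
  understand is its behaviour at \<open>P\<^sub>4 = (0,0)\<close>, i.e. as \<open>|Z| \<rightarrow> \<infinity>\<close>. There \<open>\<Delta> = 1\<close>, and the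
  linearisation of the Emden system is \<open>-r\<close> times the identity. So the variable
  \<open>\<tau> = |Z| powr (-r)\<close> and the blown-up unknowns \<open>S = \<sigma> / \<tau>\<close>, \<open>V = w / \<tau>\<close> are the right ones: because
  the linear part is scalar and the remainder is quadratic, the singularity at \<open>\<tau> = 0\<close> cancels
  completely and \<open>(S, V)\<close> solves an ordinary differential equation with a smooth right-hand side up to
  and including \<open>\<tau> = 0\<close> (lemma \<open>profile_far_ode\<close>).

  The right-hand side is quadratic in \<open>(S, V)\<close>, so a solution could still blow up as \<open>\<tau> \<rightarrow> 0\<close>, but only at
  the rate \<open>1 / \<tau>\<close>; convergence to \<open>P\<^sub>4\<close> says \<open>\<tau> S, \<tau> V \<rightarrow> 0\<close> and excludes that (lemma
  \<open>quadratic_growth_bounded\<close>). Hence \<open>S\<close> and \<open>V\<close> extend to smooth functions on some \<open>[0, b]\<close>, with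
  \<open>S 0 > 0\<close> because \<open>S'/S\<close> is bounded (lemma \<open>far_ode_smooth_extension\<close>).

  For the self-similar flow with \<open>\<lambda>\<^sub>0 = r\<close>, the value that makes the time derivative reproduce the terms
  \<open>l (r - 1) \<rho> + Z \<cdot> \<nabla>\<rho>\<close> and \<open>(r - 1) u + (Z \<cdot> \<nabla>) u\<close> of the stationary system (lemma
  \<open>selfsimilar_euler_solution\<close>), one has \<open>\<tau> = r powr r * (T - t) / |y| powr r\<close>, and all powers of
  \<open>T - t\<close> cancel in the far-field representation:
  \<open>\<rho> = (const * |y| powr (1 - r) * S \<tau>) powr l\<close> and
  \<open>u = - const * |y| powr (- r) * V \<tau> * y\<close>.
  This representation is smooth in \<open>(t, y)\<close> up to \<open>t = T\<close> as long as \<open>y \<noteq> 0\<close>, which gives smoothness away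
  from the concentration point; letting \<open>\<tau> \<rightarrow> 0\<close> gives the asymptotics with \<open>\<rho>\<^sub>*\<close> and \<open>u\<^sub>*\<close> read off from
  \<open>S 0\<close> and \<open>V 0\<close>, and the decay.

  Finally \<open>\<rho> powr \<gamma>\<close> is comparable to \<open>|y| powr (- (l + 2) (r - 1))\<close> at infinity, and the critical speeds
  satisfy \<open>(l + 2) (r - 1) \<le> d\<close> (lemma \<open>subcritical_speed_bound\<close>), so the energy diverges at least
  logarithmically.
\<close>

section \<open>Calculus of relatively smooth functions\<close>

lemma Ck_on_Suc_imp: "Ck_on (Suc k) S f \<Longrightarrow> Ck_on k S f"
proof (induction k arbitrary: f)
  case 0
  then show ?case
    by (auto simp: continuous_on_eq_continuous_within intro: has_derivative_continuous)
next
  case (Suc k)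
  then obtain D where D: "\<forall>x\<in>S. (f has_derivative D x) (at x within S)"
    "\<And>v. Ck_on (Suc k) S (\<lambda>x. D x v)"
    by auto
  with Suc.IH show ?case by auto
qed

lemma Ck_on_cong:
  assumes "Ck_on k S f" "\<And>x. x \<in> S \<Longrightarrow> f x = g x"
  shows "Ck_on k S g"
proof (cases k)
  case 0
  with assms show ?thesis by (simp cong: continuous_on_cong)
next
  case (Suc j)
  with assms(1) obtain D where D: "\<forall>x\<in>S. (f has_derivative D x) (at x within S)"
    "\<And>v. Ck_on j S (\<lambda>x. D x v)"
    by auto
  have "(g has_derivative D x) (at x within S)" if "x \<in> S" for x
    using has_derivative_transform[OF that _ bspec[OF D(1) that], of g] assms(2) by simp
  then show ?thesis using D(2) Suc by auto
qed

lemma Ck_on_const [simp]: "Ck_on k S (\<lambda>x. c)"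
proof (induction k arbitrary: c)
  case (Suc k)
  then show ?case by (auto intro!: exI[of _ "\<lambda>x v. 0"])
qed auto

lemma Ck_on_bounded_linear:
  assumes "bounded_linear L"
  shows "Ck_on k S L"
proof (cases k)
  case 0
  then show ?thesis by (simp add: linear_continuous_on[OF assms])
next
  case (Suc j)
  then show ?thesis
    using bounded_linear_imp_has_derivative[OF assms] by (auto intro!: exI[of _ "\<lambda>x. L"])
qed

lemma Ck_on_add:
  assumes "Ck_on k S f" "Ck_on k S g"
  shows "Ck_on k S (\<lambda>x. f x + g x)"
  using assms
proof (induction k arbitrary: f g)
  case 0
  then show ?case by (auto intro: continuous_on_add)
next
  case (Suc k)
  then obtain D E where D: "\<forall>x\<in>S. (f has_derivative D x) (at x within S)"
    "\<And>v. Ck_on k S (\<lambda>x. D x v)" and E: "\<forall>x\<in>S. (g has_derivative E x) (at x within S)"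
    "\<And>v. Ck_on k S (\<lambda>x. E x v)"
    by auto
  have "Ck_on k S (\<lambda>x. D x v + E x v)" for v
    by (intro Suc.IH D E)
  moreover have "((\<lambda>x. f x + g x) has_derivative (\<lambda>v. D x v + E x v)) (at x within S)" if "x \<in> S" for x
    using D(1) E(1) that by (intro has_derivative_add) auto
  ultimately show ?case
    unfolding Ck_on.simps by (intro exI conjI ballI allI)
qed

lemma (in bounded_bilinear) Ck_on:
  assumes "Ck_on k S f" "Ck_on k S g"
  shows "Ck_on k S (\<lambda>x. prod (f x) (g x))"
  using assms
proof (induction k arbitrary: f g)
  case 0
  then show ?case by (auto intro: continuous_on)
next
  case (Suc k)
  from Suc.prems(1) obtain D where "\<forall>x\<in>S. (f has_derivative D x) (at x within S)"
    "\<forall>v. Ck_on k S (\<lambda>x. D x v)"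
    by auto
  note D = this[rule_format]
  from Suc.prems(2) obtain E where "\<forall>x\<in>S. (g has_derivative E x) (at x within S)"
    "\<forall>v. Ck_on k S (\<lambda>x. E x v)"
    by auto
  note E = this[rule_format]
  have fg: "Ck_on k S f" "Ck_on k S g"
    by (rule Ck_on_Suc_imp[OF Suc.prems(1)], rule Ck_on_Suc_imp[OF Suc.prems(2)])
  have "Ck_on k S (\<lambda>x. prod (f x) (E x v) + prod (D x v) (g x))" for v
    by (intro Ck_on_add Suc.IH fg D(2) E(2))
  with FDERIV[OF D(1) E(1)] show ?case
    unfolding Ck_on.simps by (intro exI conjI ballI allI)
qed

lemmas Ck_on_mult = bounded_bilinear.Ck_on[OF bounded_bilinear_mult]
lemmas Ck_on_scaleR = bounded_bilinear.Ck_on[OF bounded_bilinear_scaleR]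
lemmas Ck_on_inner = bounded_bilinear.Ck_on[OF bounded_bilinear_inner]

lemma Ck_on_sum:
  assumes "\<And>i. i \<in> I \<Longrightarrow> Ck_on k S (f i)"
  shows "Ck_on k S (\<lambda>x. \<Sum>i\<in>I. f i x)"
  using assms by (induction I rule: infinite_finite_induct) (auto intro: Ck_on_add)

text \<open>
  Expanding \<open>D f x v\<close> in the basis turns the derivative of \<open>g \<circ> f\<close> into a finite sum of products of
  functions of class \<open>k\<close>, each with a fixed direction, which is the shape that the recursion
  for \<open>Ck_on\<close> needs.
\<close>

lemma Ck_on_compose:
  fixes f :: "'a::euclidean_space \<Rightarrow> 'b::euclidean_space"
  assumes "Ck_on k T g" "Ck_on k S f" "f ` S \<subseteq> T"
  shows "Ck_on k S (\<lambda>x. g (f x))"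
  using assms
proof (induction k arbitrary: g)
  case 0
  then show ?case by (auto intro: continuous_on_compose2)
next
  case (Suc k)
  from Suc.prems(2) obtain D where "\<forall>x\<in>S. (f has_derivative D x) (at x within S)"
    "\<forall>v. Ck_on k S (\<lambda>x. D x v)"
    by auto
  note D = this[rule_format]
  from Suc.prems(1) obtain E where "\<forall>x\<in>T. (g has_derivative E x) (at x within T)"
    "\<forall>v. Ck_on k T (\<lambda>x. E x v)"
    by auto
  note E = this[rule_format]
  have f: "Ck_on k S f"
    by (rule Ck_on_Suc_imp[OF Suc.prems(2)])
  have der: "((\<lambda>x. g (f x)) has_derivative (\<lambda>v. E (f x) (D x v))) (at x within S)"
    if x: "x \<in> S" for x
  proof -
    have "f x \<in> T" using x Suc.prems(3) by auto
    from has_derivative_subset[OF E(1)[OF this] Suc.prems(3)]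
    show ?thesis using diff_chain_within[OF D(1)[OF x]] by (simp add: o_def)
  qed
  have "Ck_on k S (\<lambda>x. E (f x) (D x v))" for v
  proof (rule Ck_on_cong)
    show "Ck_on k S (\<lambda>x. \<Sum>b\<in>Basis. (D x v \<bullet> b) *\<^sub>R E (f x) b)"
      by (intro Ck_on_sum Ck_on_scaleR Ck_on_inner D E Ck_on_const Suc.IH f Suc.prems)
    show "(\<Sum>b\<in>Basis. (D x v \<bullet> b) *\<^sub>R E (f x) b) = E (f x) (D x v)" if "x \<in> S" for x
    proof -
      have "linear (E (f x))"
        using E(1) that Suc.prems(3) by (auto intro: has_derivative_linear)
      then have "(\<Sum>b\<in>Basis. (D x v \<bullet> b) *\<^sub>R E (f x) b) = E (f x) (\<Sum>b\<in>Basis. (D x v \<bullet> b) *\<^sub>R b)"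
        by (simp add: linear_sum linear_scale)
      then show ?thesis
        by (simp add: euclidean_representation)
    qed
  qed
  with der show ?case
    unfolding Ck_on.simps by (intro exI conjI ballI allI)
qed

lemma Ck_on_real_powr: "Ck_on k {0<..} (\<lambda>x::real. x powr a)"
proof (induction k arbitrary: a)
  case 0
  then show ?case by (auto intro!: continuous_intros)
next
  case (Suc k)
  have "((\<lambda>x::real. x powr a) has_derivative (\<lambda>v. (a * v) * x powr (a - 1))) (at x within {0<..})"
    if "x \<in> {0<..}" for x
  proof -
    have "((\<lambda>x. x powr a) has_real_derivative a * x powr (a - 1)) (at x within {0<..})"
      using that has_real_derivative_powr[of x a] by (auto intro: has_field_derivative_at_within)
    then show ?thesis
      unfolding has_field_derivative_def by (rule has_derivative_eq_rhs) (auto simp: fun_eq_iff)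
  qed
  moreover have "Ck_on k {0<..} (\<lambda>x. (a * v) * x powr (a - 1))" for v
    by (intro Ck_on_mult Ck_on_const Suc)
  ultimately show ?case
    unfolding Ck_on.simps by (intro exI conjI ballI allI)
qed

lemma Ck_on_powr:
  assumes "Ck_on k S f" "\<And>x. x \<in> S \<Longrightarrow> f x > (0::real)"
  shows "Ck_on k S (\<lambda>x. f x powr a)"
  by (rule Ck_on_compose[OF Ck_on_real_powr assms(1)]) (use assms(2) in auto)

lemma Ck_on_divide:
  assumes "Ck_on k S f" "Ck_on k S g" "\<And>x. x \<in> S \<Longrightarrow> g x > (0::real)"
  shows "Ck_on k S (\<lambda>x. f x / g x)"
proof (rule Ck_on_cong)
  show "Ck_on k S (\<lambda>x. f x * g x powr (-1))"
    by (intro Ck_on_mult Ck_on_powr assms)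
qed (use assms in \<open>auto simp: powr_minus_divide less_imp_le\<close>)

lemma Ck_on_norm: 
  assumes "Ck_on k S f" "\<And>x. x \<in> S \<Longrightarrow> f x \<noteq> (0::'b::real_inner)"
  shows "Ck_on k S (\<lambda>x. norm (f x))"
proof (rule Ck_on_cong)
  show "Ck_on k S (\<lambda>x. (f x \<bullet> f x) powr (1/2))"
    by (intro Ck_on_inner Ck_on_powr assms) (use assms in auto)
qed (auto simp: norm_eq_sqrt_inner powr_half_sqrt)

text \<open>
  Smoothness is local, but derivatives within an arbitrary set need not be unique, so the two families
  of derivatives could disagree on the overlap. The overlap of the open set \<open>A\<close> with \<open>S \<inter> U\<close> is open,
  and there the derivative is unique; this makes the two families match at every order.
\<close>

lemma Ck_on_glue:
  assumes "open A" "open U" "A \<subseteq> S" "S \<subseteq> A \<union> U" "Ck_on k A f" "Ck_on k (S \<inter> U) f"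
  shows "Ck_on k S f"
  using assms(5,6)
proof (induction k arbitrary: f)
  case 0
  show ?case unfolding Ck_on.simps continuous_on_eq_continuous_within
  proof
    fix x assume x: "x \<in> S"
    show "continuous (at x within S) f"
    proof (cases "x \<in> A")
      case True
      then have "continuous (at x) f"
        using 0 assms(1) by (simp add: continuous_on_eq_continuous_at)
      then show ?thesis by (rule continuous_at_imp_continuous_at_within)
    next
      case False
      then have "x \<in> S \<inter> U" using x assms(4) by auto
      moreover then have "at x within S = at x within (S \<inter> U)"
        using assms(2) by (intro at_within_nhd[of _ U]) auto
      ultimately show ?thesis using 0(2) by (simp add: continuous_on_eq_continuous_within)
    qed
  qed
next
  case (Suc k)
  from Suc.prems(1) obtain D where "\<forall>x\<in>A. (f has_derivative D x) (at x within A)"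
    "\<forall>v. Ck_on k A (\<lambda>x. D x v)"
    by auto
  note D = this[rule_format]
  from Suc.prems(2) obtain E where "\<forall>x\<in>S \<inter> U. (f has_derivative E x) (at x within S \<inter> U)"
    "\<forall>v. Ck_on k (S \<inter> U) (\<lambda>x. E x v)"
    by auto
  note E = this[rule_format]
  have DA: "(f has_derivative D x) (at x)" if "x \<in> A" for x
    using D(1)[OF that] unfolding at_within_open[OF that assms(1)] .
  have eq: "D x = E x" if x: "x \<in> A" "x \<in> U" for x
  proof -
    have "at x within (S \<inter> U) = at x"
      using x assms(1-3) by (intro at_within_nhd[of x "A \<inter> U"]) auto
    then have "(f has_derivative E x) (at x)"
      using E(1)[of x] x assms(3) by auto
    with DA[OF x(1)] show ?thesis by (rule has_derivative_unique)
  qed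
  define G where "G x = (if x \<in> A then D x else E x)" for x
  have GU: "G x = E x" if "x \<in> S \<inter> U" for x
    using that eq by (auto simp: G_def)
  have "(f has_derivative G x) (at x within S)" if x: "x \<in> S" for x
  proof (cases "x \<in> A")
    case True
    then show ?thesis using DA by (auto simp: G_def intro: has_derivative_at_withinI)
  next
    case False
    then have xU: "x \<in> S \<inter> U" using x assms(4) by auto
    then have "at x within S = at x within (S \<inter> U)"
      using assms(2) by (intro at_within_nhd[of _ U]) auto
    then show ?thesis using E(1)[OF xU] GU[OF xU] by simp
  qed
  moreover have "Ck_on k S (\<lambda>x. G x v)" for v
  proof (rule Suc.IH)
    show "Ck_on k A (\<lambda>x. G x v)"
      by (rule Ck_on_cong[OF D(2)[of v]]) (simp add: G_def)
    show "Ck_on k (S \<inter> U) (\<lambda>x. G x v)"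
      by (rule Ck_on_cong[OF E(2)[of v]]) (use GU in auto)
  qed
  ultimately show ?case
    unfolding Ck_on.simps by (intro exI conjI ballI allI)
qed

section \<open>Radial fields and the Emden system\<close>

lemma sgn_inner_self: "sgn Z \<bullet> Z = norm (Z::'a::real_inner)"
  by (cases "Z = 0") (auto simp: sgn_div_norm dot_square_norm power2_eq_square)

lemma radial_scalar_has_derivative:
  fixes Z :: "'a::euclidean_space"
  assumes "\<And>Z::'a. f Z = \<phi> (norm Z)" "Z \<noteq> 0" "(\<phi> has_real_derivative \<phi>') (at (norm Z))"
  shows "(f has_derivative (\<lambda>v. \<phi>' * (sgn Z \<bullet> v))) (at Z)"
proof -
  have "((\<lambda>z. \<phi> (norm z)) has_derivative (\<lambda>v. \<phi>' * (sgn Z \<bullet> v))) (at Z)"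
    using diff_chain_at[OF has_derivative_norm[OF assms(2)] assms(3)[unfolded has_field_derivative_def]]
    by (simp add: o_def inner_commute)
  then show ?thesis using assms(1) by presburger
qed

lemma grad_radial:
  fixes Z :: "'a::euclidean_space"
  assumes "\<And>Z::'a. f Z = \<phi> (norm Z)" "Z \<noteq> 0" "(\<phi> has_real_derivative \<phi>') (at (norm Z))"
  shows "grad f Z = \<phi>' *\<^sub>R sgn Z"
proof -
  have "grad f Z = (\<Sum>b\<in>Basis. (\<phi>' * (sgn Z \<bullet> b)) *\<^sub>R b)"
    unfolding grad_def frechet_derivative_at[OF radial_scalar_has_derivative[OF assms], symmetric] ..
  also have "\<dots> = \<phi>' *\<^sub>R (\<Sum>b\<in>Basis. (sgn Z \<bullet> b) *\<^sub>R b)"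
    by (simp add: scaleR_sum_right)
  finally show ?thesis
    by (simp add: euclidean_representation)
qed

lemma radial_field_has_derivative:
  fixes Z :: "'a::euclidean_space"
  assumes "\<And>Z::'a. F Z = \<eta> (norm Z) *\<^sub>R Z" "Z \<noteq> 0" "(\<eta> has_real_derivative \<eta>') (at (norm Z))"
  shows "(F has_derivative (\<lambda>v. \<eta> (norm Z) *\<^sub>R v + (\<eta>' * (sgn Z \<bullet> v)) *\<^sub>R Z)) (at Z)"
proof -
  have "((\<lambda>z. \<eta> (norm z) *\<^sub>R z) has_derivative
      (\<lambda>v. \<eta> (norm Z) *\<^sub>R v + (\<eta>' * (sgn Z \<bullet> v)) *\<^sub>R Z)) (at Z)"
    by (rule has_derivative_scaleR[OF radial_scalar_has_derivative[OF refl assms(2,3)] has_derivative_ident])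
  then show ?thesis using assms(1) by presburger
qed

lemma divergence_radial:
  fixes Z :: "'a::euclidean_space"
  assumes "\<And>Z::'a. F Z = \<eta> (norm Z) *\<^sub>R Z" "Z \<noteq> 0" "(\<eta> has_real_derivative \<eta>') (at (norm Z))"
  shows "divergence F Z = real DIM('a) * \<eta> (norm Z) + \<eta>' * norm Z"
proof -
  have "divergence F Z = (\<Sum>b\<in>Basis. \<eta> (norm Z) * (b \<bullet> b) + \<eta>' * ((sgn Z \<bullet> b) * (Z \<bullet> b)))"
    unfolding divergence_def frechet_derivative_at[OF radial_field_has_derivative[OF assms], symmetric]
    by (simp add: inner_add_left mult.assoc)
  also have "\<dots> = real DIM('a) * \<eta> (norm Z) + \<eta>' * (\<Sum>b\<in>Basis. (sgn Z \<bullet> b) * (Z \<bullet> b))"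
    by (simp add: sum.distrib sum_distrib_left)
  also have "(\<Sum>b\<in>Basis. (sgn Z \<bullet> b) * (Z \<bullet> b)) = sgn Z \<bullet> Z"
    by (rule euclidean_inner[symmetric])
  also have "\<dots> = norm Z"
    by (rule sgn_inner_self)
  finally show ?thesis .
qed

lemma dir_deriv_radial_scalar:
  fixes Z :: "'a::euclidean_space"
  assumes "\<And>Z::'a. f Z = \<phi> (norm Z)" "Z \<noteq> 0" "(\<phi> has_real_derivative \<phi>') (at (norm Z))"
  shows "dir_deriv (c *\<^sub>R Z) f Z = c * \<phi>' * norm Z"
  unfolding dir_deriv_def frechet_derivative_at[OF radial_scalar_has_derivative[OF assms], symmetric]
  by (simp add: sgn_inner_self)

lemma dir_deriv_radial_field:
  fixes Z :: "'a::euclidean_space"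
  assumes "\<And>Z::'a. F Z = \<eta> (norm Z) *\<^sub>R Z" "Z \<noteq> 0" "(\<eta> has_real_derivative \<eta>') (at (norm Z))"
  shows "dir_deriv (c *\<^sub>R Z) F Z = (c * (\<eta> (norm Z) + \<eta>' * norm Z)) *\<^sub>R Z"
  unfolding dir_deriv_def frechet_derivative_at[OF radial_field_has_derivative[OF assms], symmetric]
  by (simp add: sgn_inner_self algebra_simps)

lemma smooth_on_UNIV_differentiable:
  assumes "smooth_on UNIV f"
  shows "f differentiable (at x)"
proof -
  have "Ck_on (Suc 0) UNIV f"
    using assms unfolding smooth_on_def by blast
  then show ?thesis by (auto simp: differentiable_def)
qed

text \<open>
  The radial functions are recovered by restricting the fields to a coordinate half-line.
\<close>

lemma spherical_profiles_differentiable: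
  fixes \<rho> :: "'a::euclidean_space \<Rightarrow> real" and u :: "'a \<Rightarrow> 'a"
  assumes diff: "\<And>Z. \<rho> differentiable (at Z)" "\<And>Z. u differentiable (at Z)"
    and f: "\<And>Z. \<rho> Z = f (norm Z)" and g: "\<And>Z. u Z = g (norm Z) *\<^sub>R Z" and s: "s > 0"
  shows "f field_differentiable (at s)" "g field_differentiable (at s)"
proof -
  obtain e :: 'a where e: "e \<in> Basis" using nonempty_Basis by blast
  have line: "(\<lambda>s. s *\<^sub>R e) differentiable (at s)"
    by (intro derivative_intros)
  have "(\<lambda>s. \<rho> (s *\<^sub>R e)) differentiable (at s)"
    using differentiable_chain_at[OF line diff(1)] by (simp add: o_def)
  then have 1: "(\<lambda>s. \<rho> (s *\<^sub>R e)) field_differentiable (at s)"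
    by (metis DERIV_deriv_iff_real_differentiable field_differentiable_def)
  show "f field_differentiable (at s)"
  proof -
    have "\<rho> (s *\<^sub>R e) = f s" if "s > 0" for s
      using that e by (simp add: f)
    then show ?thesis
      using 1 s has_field_derivative_transform_within_open[where S = "{0<..}" and a = s and g = f]
      unfolding field_differentiable_def by fastforce
  qed
  have "(\<lambda>s. u (s *\<^sub>R e)) differentiable (at s)"
    using differentiable_chain_at[OF line diff(2)] by (simp add: o_def)
  then have "(\<lambda>s. u (s *\<^sub>R e) \<bullet> e / s) differentiable (at s)"
    using s by (intro derivative_intros) auto
  then have 2: "(\<lambda>s. u (s *\<^sub>R e) \<bullet> e / s) field_differentiable (at s)"
    by (metis DERIV_deriv_iff_real_differentiable field_differentiable_def)
  show "g field_differentiable (at s)"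
  proof -
    have "u (s *\<^sub>R e) \<bullet> e / s = g s" if "s > 0" for s
      using that e by (simp add: g)
    then show ?thesis
      using 2 s has_field_derivative_transform_within_open[where S = "{0<..}" and a = s and g = g]
      unfolding field_differentiable_def by fastforce
  qed
qed

text \<open>
  The stationary system along a ray. The momentum equation is a multiple of \<open>Z\<close>, and the
  pressure term is written with \<open>f powr (2 / l)\<close>, as \<open>\<gamma> - 1 = 2 / l\<close>.
\<close>

lemma stationary_euler_radial:
  fixes \<rho> :: "'a::euclidean_space \<Rightarrow> real" and u :: "'a \<Rightarrow> 'a"
  assumes eq: "stationary_euler \<gamma> l r \<rho> u" and \<gamma>: "\<gamma> = 1 + 2 / l"
    and f: "\<And>Z. \<rho> Z = f (norm Z)" and g: "\<And>Z. u Z = g (norm Z) *\<^sub>R Z"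
    and s: "s > 0" and pos: "f s > 0"
    and f': "(f has_real_derivative f') (at s)" and g': "(g has_real_derivative g') (at s)"
  shows "l * (r - 1) * f s + f' * s + (real DIM('a) * (f s * g s) + (f' * g s + f s * g') * s) = 0"
    and "(r - 1) * g s + (g s + g' * s) + g s * (g s + g' * s)
           + 2 / l * f s powr (2 / l) * f' / (f s * s) = 0"
proof -
  obtain e :: 'a where e: "e \<in> Basis" using nonempty_Basis by blast
  define Z where "Z = s *\<^sub>R e"
  have Z: "norm Z = s" "Z \<noteq> 0" "sgn Z = (1 / s) *\<^sub>R Z"
    using s e by (auto simp: Z_def sgn_div_norm divide_inverse)
  have f'Z: "(f has_real_derivative f') (at (norm Z))" and g'Z: "(g has_real_derivative g') (at (norm Z))"
    using f' g' Z by auto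
  have fg: "((\<lambda>s. f s * g s) has_real_derivative f' * g s + f s * g') (at (norm Z))"
    using DERIV_mult[OF f' g'] Z by (simp add: ac_simps)
  have P: "((\<lambda>s. f s powr (\<gamma> - 1)) has_real_derivative 2 / l * f s powr (2 / l) * f' / f s) (at (norm Z))"
    unfolding Z(1) using f' pos
    by (auto intro!: derivative_eq_intros simp: \<gamma> powr_diff)
  have div: "divergence (\<lambda>z. \<rho> z *\<^sub>R u z) Z = real DIM('a) * (f s * g s) + (f' * g s + f s * g') * s"
    using divergence_radial[OF _ Z(2) fg, of "\<lambda>z. \<rho> z *\<^sub>R u z"] f g Z(1) by auto
  have D1: "dir_deriv Z \<rho> Z = f' * s"
    using dir_deriv_radial_scalar[OF f Z(2) f'Z, of 1] Z(1) by simp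
  have D2: "dir_deriv (c *\<^sub>R Z) u Z = (c * (g s + g' * s)) *\<^sub>R Z" for c
    using dir_deriv_radial_field[OF g Z(2) g'Z, of c] Z(1) by simp
  have G: "grad (\<lambda>z. \<rho> z powr (\<gamma> - 1)) Z = (2 / l * f s powr (2 / l) * f' / f s) *\<^sub>R sgn Z"
    using grad_radial[OF _ Z(2) P, of "\<lambda>z. \<rho> z powr (\<gamma> - 1)"] f by auto
  have E: "l * (r - 1) * \<rho> Z + dir_deriv Z \<rho> Z + divergence (\<lambda>z. \<rho> z *\<^sub>R u z) Z = 0"
    "(r - 1) *\<^sub>R u Z + dir_deriv Z u Z + dir_deriv (u Z) u Z + grad (\<lambda>z. \<rho> z powr (\<gamma> - 1)) Z = 0"
    using eq unfolding stationary_euler_def by blast+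
  show "l * (r - 1) * f s + f' * s + (real DIM('a) * (f s * g s) + (f' * g s + f s * g') * s) = 0"
    using E(1) unfolding div D1 unfolding f Z(1) .
  have uZ: "u Z = g s *\<^sub>R Z" using g Z by simp
  have "((r - 1) * g s + (g s + g' * s) + g s * (g s + g' * s)
           + 2 / l * f s powr (2 / l) * f' / (f s * s)) *\<^sub>R Z
        = (r - 1) *\<^sub>R u Z + dir_deriv Z u Z + dir_deriv (u Z) u Z + grad (\<lambda>z. \<rho> z powr (\<gamma> - 1)) Z"
    unfolding G uZ Z(3) D2 D2[of 1, simplified] by (simp add: scaleR_add_left mult.assoc)
  then show "(r - 1) * g s + (g s + g' * s) + g s * (g s + g' * s)
           + 2 / l * f s powr (2 / l) * f' / (f s * s) = 0"
    using E(2) Z(2) by simp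
qed

text \<open>
  Here \<open>X\<close> and \<open>Y\<close> stand for \<open>d\<sigma>/dx\<close> and \<open>dw/dx\<close>: the two radial equations are linear in them, with
  determinant \<open>\<Delta>\<close> up to a factor, and solving them gives the Emden system.
\<close>

lemma emden_algebra:
  fixes d l r \<sigma> w X Y :: real
  assumes l: "l \<noteq> 0" and d: "d \<noteq> 0"
    and mass: "l * (r - 1) * \<sigma> + l * (\<sigma> + X) * (1 - w) - d * w * \<sigma> - Y * \<sigma> = 0"
    and mom: "- (r - 1) * w - w - Y + w * (w + Y) + l * (\<sigma>\<^sup>2 + \<sigma> * X) = 0"
  shows "((w - 1)\<^sup>2 - \<sigma>\<^sup>2) * X = - Delta2 d l r \<sigma> w"
    and "((w - 1)\<^sup>2 - \<sigma>\<^sup>2) * Y = - Delta1 d l r \<sigma> w"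
proof -
  have D1: "Delta1 d l r \<sigma> w = w * (w - 1) * (w - r) - (d * w - l * (r - 1)) * \<sigma>\<^sup>2"
    using d by (simp add: Delta1_def w_e_def field_simps)
  have D2: "l * Delta2 d l r \<sigma> w = \<sigma> * ((l + d - 1) * w\<^sup>2 - (l + d + l * r - r) * w + l * r - l * \<sigma>\<^sup>2)"
    using l by (simp add: Delta2_def)
  have "l * (((w - 1)\<^sup>2 - \<sigma>\<^sup>2) * X) = - (l * Delta2 d l r \<sigma> w)"
    unfolding D2 using mass mom by algebra
  then show "((w - 1)\<^sup>2 - \<sigma>\<^sup>2) * X = - Delta2 d l r \<sigma> w"
    using l by (metis mult_left_cancel mult_minus_right)
  show "((w - 1)\<^sup>2 - \<sigma>\<^sup>2) * Y = - Delta1 d l r \<sigma> w"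
    unfolding D1 using mass mom by algebra
qed

text \<open>
  The variable \<open>\<sigma>\<close> as a function of \<open>s = |Z|\<close> instead of \<open>x = ln s\<close>.
\<close>

definition emden_sigma :: "real \<Rightarrow> (real \<Rightarrow> real) \<Rightarrow> real \<Rightarrow> real" where
  "emden_sigma l f s = f s powr (1 / l) / (sqrt (l / 2) * s)"

lemma emden_system:
  fixes \<rho> :: "'a::euclidean_space \<Rightarrow> real" and u :: "'a \<Rightarrow> 'a"
  assumes eq: "stationary_euler \<gamma> l r \<rho> u" and \<gamma>: "\<gamma> = 1 + 2 / l" and l: "l > 0"
    and smooth: "smooth_on UNIV \<rho>" "smooth_on UNIV u"
    and f: "\<And>Z. \<rho> Z = f (norm Z)" and g: "\<And>Z. u Z = g (norm Z) *\<^sub>R Z"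
    and s: "s > 0" and pos: "\<And>s. s > 0 \<Longrightarrow> f s > 0"
  obtains X Y where
    "(emden_sigma l f has_real_derivative X / s) (at s)"
    "(g has_real_derivative - Y / s) (at s)"
    "((- g s - 1)\<^sup>2 - (emden_sigma l f s)\<^sup>2) * X = - Delta2 (real DIM('a)) l r (emden_sigma l f s) (- g s)"
    "((- g s - 1)\<^sup>2 - (emden_sigma l f s)\<^sup>2) * Y = - Delta1 (real DIM('a)) l r (emden_sigma l f s) (- g s)"
proof -
  have diff: "f field_differentiable (at s)" "g field_differentiable (at s)"
    using spherical_profiles_differentiable[OF smooth[THEN smooth_on_UNIV_differentiable] f g s] by blast+
  then obtain f' g' where f': "(f has_real_derivative f') (at s)" and g': "(g has_real_derivative g') (at s)"
    unfolding field_differentiable_def by blast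
  note E = stationary_euler_radial[OF eq \<gamma> f g s pos[OF s] f' g']
  define \<sigma> where "\<sigma> = emden_sigma l f s"
  define X where "X = \<sigma> * (s * f' / (l * f s) - 1)"
  define Y where "Y = - (s * g')"
  have fs: "f s > 0" using pos s .
  have \<sigma>: "\<sigma> > 0" using l s fs by (simp add: \<sigma>_def emden_sigma_def)
  have sum: "l * (\<sigma> + X) = \<sigma> * s * f' / f s"
    using l fs by (simp add: X_def field_simps)
  have powr2: "f s powr (2 / l) = l / 2 * s\<^sup>2 * \<sigma>\<^sup>2"
  proof -
    have "f s powr (1 / l) = sqrt (l / 2) * s * \<sigma>"
      using s l by (simp add: \<sigma>_def emden_sigma_def)
    moreover have "f s powr (2 / l) = (f s powr (1 / l))\<^sup>2"
      by (simp add: power2_eq_square flip: powr_add)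
    ultimately show ?thesis using l by (simp add: power_mult_distrib)
  qed
  have mass: "l * (r - 1) * \<sigma> + l * (\<sigma> + X) * (1 - - g s) - real DIM('a) * - g s * \<sigma> - Y * \<sigma> = 0"
  proof -
    have "(l * (r - 1) * \<sigma> + l * (\<sigma> + X) * (1 - - g s) - real DIM('a) * - g s * \<sigma> - Y * \<sigma>)
      = \<sigma> / f s * (l * (r - 1) * f s + f' * s + (real DIM('a) * (f s * g s) + (f' * g s + f s * g') * s))"
      unfolding sum Y_def using fs by (simp add: field_simps)
    then show ?thesis using E(1) by simp
  qed
  have mom: "- (r - 1) * - g s - - g s - Y + - g s * (- g s + Y) + l * (\<sigma>\<^sup>2 + \<sigma> * X) = 0"
  proof -
    have "l * (\<sigma>\<^sup>2 + \<sigma> * X) = \<sigma> * (l * (\<sigma> + X))" by (simp add: algebra_simps power2_eq_square)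
    also have "\<dots> = 2 / l * f s powr (2 / l) * f' / (f s * s)"
      unfolding sum powr2 using s l fs by (simp add: field_simps power2_eq_square)
    finally show ?thesis using E(2) by (simp add: Y_def algebra_simps)
  qed
  have "(emden_sigma l f has_real_derivative X / s) (at s)"
  proof -
    have "((\<lambda>s. f s powr (1 / l) / (sqrt (l / 2) * s)) has_real_derivative
       ((1 / l * f s powr (1 / l - 1) * f') * (sqrt (l / 2) * s) - f s powr (1 / l) * sqrt (l / 2)) / (sqrt (l / 2) * s)\<^sup>2) (at s)"
      using f' fs s l by (auto intro!: derivative_eq_intros simp: power2_eq_square)
    also have "((1 / l * f s powr (1 / l - 1) * f') * (sqrt (l / 2) * s) - f s powr (1 / l) * sqrt (l / 2)) / (sqrt (l / 2) * s)\<^sup>2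
       = X / s"
    proof -
      define k where "k = sqrt (l / 2)"
      have "k > 0" using l by (simp add: k_def)
      then show ?thesis
        unfolding X_def \<sigma>_def emden_sigma_def powr_diff k_def[symmetric] using fs s l
        by (simp add: field_simps power2_eq_square)
    qed
    finally show ?thesis by (simp add: emden_sigma_def[abs_def])
  qed
  moreover have "(g has_real_derivative - Y / s) (at s)"
    using g' s by (simp add: Y_def)
  ultimately show ?thesis
    using that emden_algebra[OF _ _ mass mom] l unfolding \<sigma>_def by auto
qed

text \<open>
  \<open>\<Delta>\<close> at \<open>(\<sigma>, w) = (\<tau> S, \<tau> V)\<close>; it tends to \<open>1\<close> at \<open>P\<^sub>4\<close>.
\<close>

definition far_den :: "real \<Rightarrow> real \<Rightarrow> real \<Rightarrow> real" where
  "far_den \<tau> S V = (1 - \<tau> * V)\<^sup>2 - (\<tau> * S)\<^sup>2"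

text \<open>
  The right-hand sides of the equations for \<open>S\<close> and \<open>V\<close> as functions of \<open>\<tau>\<close>. They come from
  \<open>r \<sigma> \<Delta> - \<Delta>\<^sub>2\<close> and \<open>r w \<Delta> - \<Delta>\<^sub>1\<close>, which vanish to second order at \<open>P\<^sub>4\<close>, divided by
  \<open>- r \<tau>\<^sup>2 \<Delta>\<close>.
\<close>

definition far_S' :: "real \<Rightarrow> real \<Rightarrow> real \<Rightarrow> real \<Rightarrow> real \<Rightarrow> real \<Rightarrow> real" where
  "far_S' d l r \<tau> S V = - (1 / r) * (S * (((l + d - r - l * r) / l) * V
      + \<tau> * ((r - (l + d - 1) / l) * V\<^sup>2 + (1 - r) * S\<^sup>2))) / far_den \<tau> S V"

definition far_V' :: "real \<Rightarrow> real \<Rightarrow> real \<Rightarrow> real \<Rightarrow> real \<Rightarrow> real \<Rightarrow> real" where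
  "far_V' d l r \<tau> S V = - (1 / r) * ((1 - r) * V\<^sup>2 - l * (r - 1) * S\<^sup>2
      + \<tau> * ((r - 1) * V ^ 3 + (d - r) * V * S\<^sup>2)) / far_den \<tau> S V"

text \<open>
  The cancellation behind the whole argument: with \<open>d/d\<tau> = - (1 / (r \<tau>)) d/dx\<close>, the derivative of
  \<open>\<sigma> / \<tau>\<close> is \<open>- (d\<sigma>/dx + r \<sigma>) / (r \<tau>\<^sup>2)\<close>, and the linear part \<open>- r \<sigma>\<close> of \<open>d\<sigma>/dx\<close> drops out, so that
  a factor \<open>\<tau>\<^sup>2\<close> can be divided off. The same holds for \<open>w\<close>.
\<close>

lemma far_algebra:
  fixes d l r \<tau> S V :: real
  assumes "l \<noteq> 0" "d \<noteq> 0" "r \<noteq> 0" "\<tau> \<noteq> 0" "far_den \<tau> S V \<noteq> 0"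
  shows "- (- Delta2 d l r (\<tau> * S) (\<tau> * V) / far_den \<tau> S V + r * (\<tau> * S)) / (r * \<tau>\<^sup>2) = far_S' d l r \<tau> S V"
    and "- (- Delta1 d l r (\<tau> * S) (\<tau> * V) / far_den \<tau> S V + r * (\<tau> * V)) / (r * \<tau>\<^sup>2) = far_V' d l r \<tau> S V"
proof -
  define N where "N = far_den \<tau> S V"
  have N: "N \<noteq> 0" "N = (1 - \<tau> * V)\<^sup>2 - (\<tau> * S)\<^sup>2" using assms by (auto simp: N_def far_den_def)
  have "r * (\<tau> * S) * N - Delta2 d l r (\<tau> * S) (\<tau> * V)
    = \<tau>\<^sup>2 * (S * (((l + d - r - l * r) / l) * V
      + \<tau> * ((r - (l + d - 1) / l) * V\<^sup>2 + (1 - r) * S\<^sup>2)))"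
    unfolding N(2) Delta2_def using assms(1) by (simp add: field_simps power2_eq_square)
  then show "- (- Delta2 d l r (\<tau> * S) (\<tau> * V) / far_den \<tau> S V + r * (\<tau> * S)) / (r * \<tau>\<^sup>2) = far_S' d l r \<tau> S V"
    unfolding far_S'_def N_def[symmetric] using N(1) assms(3,4) by (simp add: divide_simps)
  have "r * (\<tau> * V) * N - Delta1 d l r (\<tau> * S) (\<tau> * V)
    = \<tau>\<^sup>2 * ((1 - r) * V\<^sup>2 - l * (r - 1) * S\<^sup>2
      + \<tau> * ((r - 1) * V ^ 3 + (d - r) * V * S\<^sup>2))"
    unfolding N(2) Delta1_def w_e_def using assms(2) by (simp add: field_simps power2_eq_square power3_eq_cube)
  then show "- (- Delta1 d l r (\<tau> * S) (\<tau> * V) / far_den \<tau> S V + r * (\<tau> * V)) / (r * \<tau>\<^sup>2) = far_V' d l r \<tau> S V"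
    unfolding far_V'_def N_def[symmetric] using N(1) assms(3,4) by (simp add: divide_simps)
qed

text \<open>
  While \<open>(\<sigma>, w)\<close> stays close to \<open>P\<^sub>4\<close>, the cubic terms carry a factor \<open>\<tau> S\<close> or \<open>\<tau> V\<close> and are as
  good as quadratic ones. The last bound, with the factor \<open>\<bar>S\<bar>\<close>, is what keeps \<open>S\<close> away from \<open>0\<close>.
\<close>

lemma far_bounds:
  fixes d l r :: real
  assumes r: "r > 0"
  obtains C where "C > 0" "\<And>\<tau> S V. 0 \<le> \<tau> \<Longrightarrow> \<tau> \<le> 1 \<Longrightarrow> \<bar>\<tau> * S\<bar> \<le> 1 / 4 \<Longrightarrow> \<bar>\<tau> * V\<bar> \<le> 1 / 4 \<Longrightarrow>
      1 / 2 \<le> far_den \<tau> S V \<and>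
      \<bar>far_S' d l r \<tau> S V\<bar> \<le> C * (S\<^sup>2 + V\<^sup>2) \<and> \<bar>far_V' d l r \<tau> S V\<bar> \<le> C * (S\<^sup>2 + V\<^sup>2)
      \<and> \<bar>far_S' d l r \<tau> S V\<bar> \<le> \<bar>S\<bar> * (C * (1 + \<bar>S\<bar> + \<bar>V\<bar>))"
proof -
  define a where "a = \<bar>(l + d - r - l * r) / l\<bar>"
  define b where "b = \<bar>r - (l + d - 1) / l\<bar>"
  define c where "c = \<bar>r - 1\<bar>"
  define e where "e = \<bar>l * (r - 1)\<bar>"
  define h where "h = \<bar>d - r\<bar>"
  define C where "C = 2 / r * (1 + a + b + 2 * c + e + h)"
  have nn: "a \<ge> 0" "b \<ge> 0" "c \<ge> 0" "e \<ge> 0" "h \<ge> 0" by (auto simp: a_def b_def c_def e_def h_def)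
  show ?thesis
  proof (rule that[of C])
    show "C > 0" using nn r by (auto simp: C_def intro!: mult_pos_pos)
    fix \<tau> S V :: real
    assume t: "0 \<le> \<tau>" "\<tau> \<le> 1" and S: "\<bar>\<tau> * S\<bar> \<le> 1 / 4" and V: "\<bar>\<tau> * V\<bar> \<le> 1 / 4"
    have den: "1 / 2 \<le> far_den \<tau> S V"
    proof -
      have "(3/4)\<^sup>2 \<le> (1 - \<tau> * V)\<^sup>2" using V by (intro power_mono) auto
      moreover have "(\<tau> * S)\<^sup>2 \<le> (1/4)\<^sup>2" using S abs_le_square_iff[of "\<tau> * S" "1/4"] by simp
      ultimately show ?thesis unfolding far_den_def by (simp add: power2_eq_square)
    qed
    have q: "\<bar>x\<bar> / r / far_den \<tau> S V \<le> 2 / r * y" if "\<bar>x\<bar> \<le> y" for x y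
    proof -
      have "\<bar>x\<bar> / r / far_den \<tau> S V \<le> (y / r) / (1 / 2)"
        using that den r by (intro frac_le divide_right_mono) (auto intro: divide_nonneg_pos)
      then show ?thesis by (simp add: ac_simps)
    qed
    have SV: "\<bar>S\<bar> * \<bar>V\<bar> \<le> S\<^sup>2 + V\<^sup>2"
    proof -
      have "0 \<le> (\<bar>S\<bar> - \<bar>V\<bar>)\<^sup>2" by simp
      then have "2 * (\<bar>S\<bar> * \<bar>V\<bar>) \<le> S\<^sup>2 + V\<^sup>2" by (simp add: power2_diff)
      moreover have "0 \<le> \<bar>S\<bar> * \<bar>V\<bar>" by simp
      ultimately show ?thesis by linarith
    qed
    define Q where "Q = S\<^sup>2 + V\<^sup>2"
    have Q0: "S\<^sup>2 \<le> Q" "V\<^sup>2 \<le> Q" "0 \<le> Q" by (auto simp: Q_def)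
    have small: "\<bar>\<tau> * S\<bar> \<le> 1" "\<bar>\<tau> * V\<bar> \<le> 1" using S V by auto
    have eS: "\<bar>far_S' d l r \<tau> S V\<bar> = \<bar>S * (((l + d - r - l * r) / l) * V
      + \<tau> * ((r - (l + d - 1) / l) * V\<^sup>2 + (1 - r) * S\<^sup>2))\<bar> / r / far_den \<tau> S V"
      unfolding far_S'_def using r den by (simp add: abs_mult)
    have eV: "\<bar>far_V' d l r \<tau> S V\<bar> = \<bar>(1 - r) * V\<^sup>2 - l * (r - 1) * S\<^sup>2
      + \<tau> * ((r - 1) * V ^ 3 + (d - r) * V * S\<^sup>2)\<bar> / r / far_den \<tau> S V"
      unfolding far_V'_def using r den by (simp add: abs_mult)
    have "\<bar>S * (((l + d - r - l * r) / l) * V + \<tau> * ((r - (l + d - 1) / l) * V\<^sup>2 + (1 - r) * S\<^sup>2))\<bar>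
       = \<bar>((l + d - r - l * r) / l) * (S * V) + ((r - (l + d - 1) / l) * ((\<tau> * S) * V\<^sup>2) + (1 - r) * ((\<tau> * S) * S\<^sup>2))\<bar>"
      by (simp add: algebra_simps)
    also have "\<dots> \<le> a * (\<bar>S\<bar> * \<bar>V\<bar>) + (b * (\<bar>\<tau> * S\<bar> * V\<^sup>2) + c * (\<bar>\<tau> * S\<bar> * S\<^sup>2))"
    proof -
      have "\<bar>x + (y + z)\<bar> \<le> \<bar>x\<bar> + (\<bar>y\<bar> + \<bar>z\<bar>)" for x y z :: real by simp
      then show ?thesis by (rule order_trans) (simp add: abs_mult a_def b_def c_def abs_minus_commute)
    qed
    also have "\<dots> \<le> a * Q + (b * (1 * Q) + c * (1 * Q))"
      using SV nn Q0 small unfolding Q_def[symmetric]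
      by (intro add_mono mult_left_mono mult_mono) auto
    also have "\<dots> \<le> (1 + a + b + 2 * c + e + h) * Q"
      using nn Q0 by (simp add: algebra_simps)
    finally have "\<bar>far_S' d l r \<tau> S V\<bar> \<le> 2 / r * ((1 + a + b + 2 * c + e + h) * Q)"
      unfolding eS by (rule q)
    then have 1: "\<bar>far_S' d l r \<tau> S V\<bar> \<le> C * (S\<^sup>2 + V\<^sup>2)"
      unfolding C_def Q_def by (simp only: mult.assoc)
    have "\<bar>(1 - r) * V\<^sup>2 - l * (r - 1) * S\<^sup>2 + \<tau> * ((r - 1) * V ^ 3 + (d - r) * V * S\<^sup>2)\<bar>
      = \<bar>(1 - r) * V\<^sup>2 - l * (r - 1) * S\<^sup>2 + ((r - 1) * ((\<tau> * V) * V\<^sup>2) + (d - r) * ((\<tau> * V) * S\<^sup>2))\<bar>"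
      by (simp add: algebra_simps power2_eq_square power3_eq_cube)
    also have "\<dots> \<le> c * V\<^sup>2 + e * S\<^sup>2 + (c * (\<bar>\<tau> * V\<bar> * V\<^sup>2) + h * (\<bar>\<tau> * V\<bar> * S\<^sup>2))"
    proof -
      have "\<bar>x - w + (y + z)\<bar> \<le> \<bar>x\<bar> + \<bar>w\<bar> + (\<bar>y\<bar> + \<bar>z\<bar>)" for x y z w :: real by simp
      then show ?thesis by (rule order_trans) (simp add: abs_mult c_def h_def e_def abs_minus_commute)
    qed
    also have "\<dots> \<le> c * Q + e * Q + (c * (1 * Q) + h * (1 * Q))"
      using nn Q0 small by (intro add_mono mult_left_mono mult_mono) auto
    also have "\<dots> \<le> (1 + a + b + 2 * c + e + h) * Q"
      using nn Q0 by (simp add: algebra_simps)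
    finally have "\<bar>far_V' d l r \<tau> S V\<bar> \<le> 2 / r * ((1 + a + b + 2 * c + e + h) * Q)"
      unfolding eV by (rule q)
    then have 2: "\<bar>far_V' d l r \<tau> S V\<bar> \<le> C * (S\<^sup>2 + V\<^sup>2)"
      unfolding C_def Q_def by (simp only: mult.assoc)
    have "\<bar>S * (((l + d - r - l * r) / l) * V + \<tau> * ((r - (l + d - 1) / l) * V\<^sup>2 + (1 - r) * S\<^sup>2))\<bar>
       = \<bar>S\<bar> * \<bar>((l + d - r - l * r) / l) * V + ((r - (l + d - 1) / l) * ((\<tau> * V) * V) + (1 - r) * ((\<tau> * S) * S))\<bar>"
      by (simp add: abs_mult[symmetric] algebra_simps power2_eq_square)
    also have "\<dots> \<le> \<bar>S\<bar> * (a * \<bar>V\<bar> + (b * (\<bar>\<tau> * V\<bar> * \<bar>V\<bar>) + c * (\<bar>\<tau> * S\<bar> * \<bar>S\<bar>)))"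
    proof -
      have tri: "\<bar>x + (y + z)\<bar> \<le> \<bar>x\<bar> + (\<bar>y\<bar> + \<bar>z\<bar>)" for x y z :: real by simp
      show ?thesis
        by (rule mult_left_mono, rule order_trans[OF tri])
           (simp_all add: abs_mult a_def b_def c_def abs_minus_commute)
    qed
    also have "\<dots> \<le> \<bar>S\<bar> * (a * \<bar>V\<bar> + (b * (1 * \<bar>V\<bar>) + c * (1 * \<bar>S\<bar>)))"
      using nn small by (intro add_mono mult_left_mono mult_mono) auto
    also have "\<dots> \<le> \<bar>S\<bar> * ((1 + a + b + 2 * c + e + h) * (1 + \<bar>S\<bar> + \<bar>V\<bar>))"
      using nn by (intro mult_left_mono) (auto simp add: algebra_simps intro!: add_nonneg_nonneg mult_nonneg_nonneg)
    finally have "\<bar>far_S' d l r \<tau> S V\<bar> \<le> 2 / r * (\<bar>S\<bar> * ((1 + a + b + 2 * c + e + h) * (1 + \<bar>S\<bar> + \<bar>V\<bar>)))"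
      unfolding eS by (rule q)
    then have 3: "\<bar>far_S' d l r \<tau> S V\<bar> \<le> \<bar>S\<bar> * (C * (1 + \<bar>S\<bar> + \<bar>V\<bar>))"
      unfolding C_def by (simp only: mult_ac)
    show "1 / 2 \<le> far_den \<tau> S V \<and>
      \<bar>far_S' d l r \<tau> S V\<bar> \<le> C * (S\<^sup>2 + V\<^sup>2) \<and> \<bar>far_V' d l r \<tau> S V\<bar> \<le> C * (S\<^sup>2 + V\<^sup>2)
      \<and> \<bar>far_S' d l r \<tau> S V\<bar> \<le> \<bar>S\<bar> * (C * (1 + \<bar>S\<bar> + \<bar>V\<bar>))"
      using den 1 2 3 by blast
  qed
qed

section \<open>Behaviour of solutions of the far-field system\<close>

text \<open>
  The derivative of \<open>1 / \<bar>(S, V)\<bar>\<close> is bounded, so this function is Lipschitz near \<open>0\<close>. If it tended to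
  \<open>0\<close>, it would be at most a constant times \<open>t\<close>, contradicting \<open>t \<bar>(S, V)\<bar> \<rightarrow> 0\<close>.
\<close>

lemma quadratic_growth_bounded:
  fixes S V S' V' :: "real \<Rightarrow> real"
  assumes t0: "t0 > 0" and C: "C > 0"
    and S: "\<And>t. t \<in> {0<..t0} \<Longrightarrow> (S has_real_derivative S' t) (at t)"
    and V: "\<And>t. t \<in> {0<..t0} \<Longrightarrow> (V has_real_derivative V' t) (at t)"
    and bound: "\<And>t. t \<in> {0<..t0} \<Longrightarrow> \<bar>S' t\<bar> \<le> C * ((S t)\<^sup>2 + (V t)\<^sup>2)"
      "\<And>t. t \<in> {0<..t0} \<Longrightarrow> \<bar>V' t\<bar> \<le> C * ((S t)\<^sup>2 + (V t)\<^sup>2)"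
    and pos: "\<And>t. t \<in> {0<..t0} \<Longrightarrow> S t > 0"
    and lim: "((\<lambda>t. t * S t) \<longlongrightarrow> 0) (at_right 0)" "((\<lambda>t. t * V t) \<longlongrightarrow> 0) (at_right 0)"
  obtains t1 M where "t1 \<in> {0<..t0}" "\<And>t. t \<in> {0<..t1} \<Longrightarrow> \<bar>S t\<bar> \<le> M \<and> \<bar>V t\<bar> \<le> M"
proof -
  define q where "q t = sqrt ((S t)\<^sup>2 + (V t)\<^sup>2)" for t
  have q: "q t > 0" "\<bar>S t\<bar> \<le> q t" "\<bar>V t\<bar> \<le> q t" "(q t)\<^sup>2 = (S t)\<^sup>2 + (V t)\<^sup>2" if "t \<in> {0<..t0}" for t
  proof -
    show "q t > 0" using pos[OF that] by (simp add: q_def sum_power2_gt_zero_iff)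
    show "\<bar>S t\<bar> \<le> q t" "\<bar>V t\<bar> \<le> q t" by (auto simp: q_def real_le_rsqrt)
    show "(q t)\<^sup>2 = (S t)\<^sup>2 + (V t)\<^sup>2" by (simp add: q_def)
  qed
  have der: "((\<lambda>t. inverse (q t)) has_real_derivative - (S t * S' t + V t * V' t) / (q t) ^ 3) (at t)"
    if t: "t \<in> {0<..t0}" for t
  proof -
    have 1: "((\<lambda>t. (S t)\<^sup>2 + (V t)\<^sup>2) has_real_derivative 2 * S t * S' t + 2 * V t * V' t) (at t)"
      using S[OF t] V[OF t] by (auto intro!: derivative_eq_intros)
    have "(S t)\<^sup>2 + (V t)\<^sup>2 > 0" using q(1)[OF t] by (simp add: q_def)
    from DERIV_chain2[OF DERIV_real_sqrt[OF this] 1]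
    have "((\<lambda>t. sqrt ((S t)\<^sup>2 + (V t)\<^sup>2)) has_real_derivative
        inverse (sqrt ((S t)\<^sup>2 + (V t)\<^sup>2)) / 2 * (2 * S t * S' t + 2 * V t * V' t)) (at t)" .
    then have "(q has_real_derivative inverse (q t) / 2 * (2 * S t * S' t + 2 * V t * V' t)) (at t)"
      unfolding q_def .
    moreover have "inverse (q t) / 2 * (2 * S t * S' t + 2 * V t * V' t) = (2 * S t * S' t + 2 * V t * V' t) / (2 * q t)"
      by (simp add: field_simps)
    ultimately have "(q has_real_derivative (2 * S t * S' t + 2 * V t * V' t) / (2 * q t)) (at t)"
      by (simp only:)
    then have "((\<lambda>t. inverse (q t)) has_real_derivative
        - (inverse (q t) * ((2 * S t * S' t + 2 * V t * V' t) / (2 * q t)) * inverse (q t))) (at t)"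
      using q(1)[OF t] by (intro DERIV_inverse') auto
    moreover have "- (inverse (q t) * ((2 * S t * S' t + 2 * V t * V' t) / (2 * q t)) * inverse (q t))
        = - (S t * S' t + V t * V' t) / (q t) ^ 3"
      using q(1)[OF t] by (simp add: field_simps power3_eq_cube)
    ultimately show ?thesis by simp
  qed
  have small: "\<bar>- (S t * S' t + V t * V' t) / (q t) ^ 3\<bar> \<le> 2 * C" if t: "t \<in> {0<..t0}" for t
  proof -
    have "\<bar>S t * S' t + V t * V' t\<bar> \<le> \<bar>S t\<bar> * \<bar>S' t\<bar> + \<bar>V t\<bar> * \<bar>V' t\<bar>"
      by (simp add: abs_mult[symmetric] abs_triangle_ineq)
    also have "\<dots> \<le> q t * (C * (q t)\<^sup>2) + q t * (C * (q t)\<^sup>2)"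
      using q(1-3)[OF t] bound[OF t] C unfolding q(4)[OF t]
      by (intro add_mono mult_mono) auto
    also have "\<dots> = 2 * C * (q t) ^ 3" by (simp add: power2_eq_square power3_eq_cube)
    finally show ?thesis using q(1)[OF t] by (simp add: abs_divide pos_divide_le_eq)
  qed
  have "\<forall>\<^sub>F t in at_right 0. \<bar>t * S t\<bar> < 1 / (8 * C) \<and> \<bar>t * V t\<bar> < 1 / (8 * C) \<and> t \<in> {0<..<t0}"
    using tendstoD[OF lim(1), of "1 / (8 * C)"] tendstoD[OF lim(2), of "1 / (8 * C)"] C
      eventually_at_right_real[OF t0]
    by (simp add: eventually_conj)
  \<comment> \<open>the constant 8 C leaves a margin: at t1 the function 1/q is at least 4 C t1, and it can lose at most 2 C t1 on the way down to 0\<close>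
  then obtain t1 where t1: "\<bar>t1 * S t1\<bar> < 1 / (8 * C)" "\<bar>t1 * V t1\<bar> < 1 / (8 * C)" "t1 \<in> {0<..<t0}"
    using eventually_happens' trivial_limit_at_right_real by (metis (mono_tags, lifting))
  have t1': "t1 \<in> {0<..t0}" using t1 by auto
  have h1: "inverse (q t1) \<ge> 4 * C * t1"
  proof -
    have "q t1 \<le> \<bar>S t1\<bar> + \<bar>V t1\<bar>" unfolding q_def using sqrt_sum_squares_le_sum_abs by blast
    then have "t1 * q t1 \<le> \<bar>t1 * S t1\<bar> + \<bar>t1 * V t1\<bar>"
      using t1(3) by (simp add: abs_mult flip: distrib_left)
    also have "\<dots> \<le> 1 / (4 * C)" using t1 C by (simp add: field_simps)
    finally show ?thesis using q(1)[OF t1'] C by (simp add: field_simps)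
  qed
  have "\<bar>S t\<bar> \<le> inverse (2 * C * t1) \<and> \<bar>V t\<bar> \<le> inverse (2 * C * t1)" if t: "t \<in> {0<..t1}" for t
  proof -
    have t': "t \<in> {0<..t0}" using t t1 by auto
    have "norm (inverse (q t1) - inverse (q t)) \<le> 2 * C * norm (t1 - t)"
    proof (rule field_differentiable_bound[of "{t..t1}"])
      show "((\<lambda>t. inverse (q t)) has_real_derivative - (S z * S' z + V z * V' z) / (q z) ^ 3) (at z within {t..t1})"
        "norm (- (S z * S' z + V z * V' z) / (q z) ^ 3) \<le> 2 * C" if "z \<in> {t..t1}" for z
      proof -
        have "z \<in> {0<..t0}" using that t t1 by auto
        then show "((\<lambda>t. inverse (q t)) has_real_derivative - (S z * S' z + V z * V' z) / (q z) ^ 3) (at z within {t..t1})"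
         "norm (- (S z * S' z + V z * V' z) / (q z) ^ 3) \<le> 2 * C"
          using der small has_field_derivative_at_within by (blast, simp only: real_norm_def)
      qed
    qed (use t in auto)
    moreover have "2 * C * norm (t1 - t) \<le> 2 * C * t1" using t C by (intro mult_left_mono) auto
    ultimately have "2 * C * t1 \<le> inverse (q t)" using h1 by auto
    moreover have "2 * C * t1 > 0" using C t1 by auto
    ultimately have "q t \<le> inverse (2 * C * t1)"
      using le_imp_inverse_le[of "2 * C * t1" "inverse (q t)"] by simp
    then show ?thesis using q[OF t'] by linarith
  qed
  then show ?thesis using that t1' by blast
qed

lemma bounded_derivative_limit_at_right:
  fixes f f' :: "real \<Rightarrow> real"
  assumes "\<And>t. t \<in> {0<..b} \<Longrightarrow> (f has_real_derivative f' t) (at t)" "b > 0"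
    and "\<And>t. t \<in> {0<..b} \<Longrightarrow> \<bar>f' t\<bar> \<le> K"
  obtains L where "(f \<longlongrightarrow> L) (at_right 0)"
proof -
  have K: "0 \<le> K" using assms(2) assms(3)[of b] by auto
  have "norm (f y - f x) \<le> K * norm (y - x)" if "x \<in> {0<..b}" "y \<in> {0<..b}" for x y
    by (rule field_differentiable_bound[of "{0<..b}" f f'])
       (use that assms in \<open>auto intro: has_field_derivative_at_within\<close>)
  then have "K-lipschitz_on {0<..b} f"
    using K by (intro lipschitz_onI) (auto simp: dist_norm norm_minus_commute)
  then have "uniformly_continuous_on {0<..b} f"
    by (rule lipschitz_on_uniformly_continuous)
  moreover have "0 \<in> closure {0<..b}"
    using assms(2) by simp
  ultimately obtain L where "(f \<longlongrightarrow> L) (at 0 within {0<..b})"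
    by (rule uniformly_continuous_on_extension_at_closure)
  moreover have "at 0 within {0<..b} = at_right 0"
    using assms(2) by (intro at_within_nhd[of _ "{..<b}"]) auto
  ultimately show ?thesis using that by simp
qed

text \<open>
  By the fundamental theorem of calculus, \<open>f\<close> is the integral of the continuous function \<open>f'\<close>, and such an
  integral is differentiable at the endpoints too.
\<close>

lemma derivative_extends_to_endpoint:
  fixes f f' :: "real \<Rightarrow> real"
  assumes b: "b > 0" and f: "continuous_on {0..b} f" and f': "continuous_on {0..b} f'"
    and der: "\<And>t. t \<in> {0<..b} \<Longrightarrow> (f has_real_derivative f' t) (at t within {0..b})"
    and t: "t \<in> {0..b}"
  shows "(f has_real_derivative f' t) (at t within {0..b})"
proof -
  have *: "f x = f 0 + integral {0..x} f'" if x: "x \<in> {0..b}" for x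
  proof -
    have "(f' has_integral (f x - f 0)) {0..x}"
    proof (rule fundamental_theorem_of_calculus_interior)
      show "continuous_on {0..x} f" using f x by (auto intro: continuous_on_subset)
      show "(f has_vector_derivative f' z) (at z)" if z: "z \<in> {0<..<x}" for z
      proof -
        have "at z within {0..b} = at z"
          using z x by (intro at_within_interior) auto
        then show ?thesis
          using der[of z] z x by (auto simp: has_real_derivative_iff_has_vector_derivative)
      qed
    qed (use x in auto)
    then show ?thesis by (simp add: integral_unique)
  qed
  have "((\<lambda>x. f 0 + integral {0..x} f') has_real_derivative f' t) (at t within {0..b})"
    using integral_has_real_derivative[OF f' t] by (auto intro!: derivative_eq_intros)
  then show ?thesis
    by (rule has_field_derivative_transform_within[where d = 1]) (use t in \<open>auto simp: *[symmetric]\<close>)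
qed

text \<open>
  Bootstrapping: a solution of class \<open>k\<close> has derivatives of class \<open>k\<close>, hence is of class \<open>k + 1\<close>.
\<close>

lemma ode_solution_Ck:
  fixes S V S' V' :: "real \<Rightarrow> real"
  assumes "\<And>t. t \<in> I \<Longrightarrow> (S has_real_derivative S' t) (at t within I)"
    and "\<And>t. t \<in> I \<Longrightarrow> (V has_real_derivative V' t) (at t within I)"
    and "\<And>k. Ck_on k I S \<Longrightarrow> Ck_on k I V \<Longrightarrow> Ck_on k I S' \<and> Ck_on k I V'"
  shows "Ck_on k I S \<and> Ck_on k I V"
proof (induction k)
  case 0
  then show ?case
    using assms(1,2) by (auto intro!: DERIV_continuous_on)
next
  case (Suc k)
  have *: "Ck_on (Suc k) I f"
    if f: "\<And>t. t \<in> I \<Longrightarrow> (f has_real_derivative f' t) (at t within I)" "Ck_on k I f'" for f f'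
  proof -
    have "Ck_on k I (\<lambda>t. f' t * v)" for v
      by (intro Ck_on_mult f(2) Ck_on_const)
    with f(1)[unfolded has_field_derivative_def] show ?thesis
      unfolding Ck_on.simps by (intro exI conjI ballI allI)
  qed
  show ?case
    using *[OF assms(1)] *[OF assms(2)] assms(3) Suc by blast
qed

lemma far_ode_Ck:
  assumes "Ck_on k I S" "Ck_on k I V" "\<And>t. t \<in> I \<Longrightarrow> far_den t (S t) (V t) > 0" "r > 0"
  shows "Ck_on k I (\<lambda>t. far_S' d l r t (S t) (V t)) \<and> Ck_on k I (\<lambda>t. far_V' d l r t (S t) (V t))"
proof -
  have id: "Ck_on k I (\<lambda>t::real. t)" by (rule Ck_on_bounded_linear) simp
  note Ck = Ck_on_add Ck_on_mult Ck_on_const id assms(1,2)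
  have den: "Ck_on k I (\<lambda>t. far_den t (S t) (V t))"
  proof (rule Ck_on_cong)
    show "Ck_on k I (\<lambda>t. (1 + (-1) * (t * V t)) * (1 + (-1) * (t * V t)) + (-1) * ((t * S t) * (t * S t)))"
      by (intro Ck)
  qed (simp add: far_den_def power2_eq_square algebra_simps)
  have 1: "Ck_on k I (\<lambda>t. - (1 / r) * (S t * (((l + d - r - l * r) / l) * V t
      + t * ((r - (l + d - 1) / l) * (V t * V t) + (1 - r) * (S t * S t)))))"
    by (intro Ck)
  have 2: "Ck_on k I (\<lambda>t. - (1 / r) * ((1 - r) * (V t * V t) + (- (l * (r - 1))) * (S t * S t)
      + t * ((r - 1) * (V t * (V t * V t)) + (d - r) * V t * (S t * S t))))"
    by (intro Ck)
  show ?thesis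
    using Ck_on_divide[OF 1 den assms(3)] Ck_on_divide[OF 2 den assms(3)]
    unfolding far_S'_def far_V'_def power2_eq_square power3_eq_cube
    by (simp add: mult.assoc)
qed

lemma profile_far_ode:
  fixes \<rho> :: "'a::euclidean_space \<Rightarrow> real" and u :: "'a \<Rightarrow> 'a"
  assumes eq: "stationary_euler \<gamma> l r \<rho> u" and \<gamma>: "\<gamma> = 1 + 2 / l" and l: "l > 0" and r: "r > 0"
    and smooth: "smooth_on UNIV \<rho>" "smooth_on UNIV u"
    and f: "\<And>Z. \<rho> Z = f (norm Z)" and g: "\<And>Z. u Z = g (norm Z) *\<^sub>R Z"
    and pos: "\<And>s. s > 0 \<Longrightarrow> f s > 0"
  defines "S \<equiv> \<lambda>\<tau>. emden_sigma l f (\<tau> powr (- 1 / r)) / \<tau>"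
    and "V \<equiv> \<lambda>\<tau>. - g (\<tau> powr (- 1 / r)) / \<tau>"
  assumes \<tau>: "\<tau> > 0" and den: "far_den \<tau> (S \<tau>) (V \<tau>) \<noteq> 0"
  shows "(S has_real_derivative far_S' (real DIM('a)) l r \<tau> (S \<tau>) (V \<tau>)) (at \<tau>)"
    and "(V has_real_derivative far_V' (real DIM('a)) l r \<tau> (S \<tau>) (V \<tau>)) (at \<tau>)"
proof -
  define s where "s = (\<lambda>\<tau>::real. \<tau> powr (- 1 / r))"
  have s: "s \<tau> > 0" using \<tau> by (simp add: s_def)
  have s': "(s has_real_derivative - (s \<tau> / (r * \<tau>))) (at \<tau>)"
  proof -
    have "- 1 / r * \<tau> powr (- 1 / r - 1) = - (s \<tau> / (r * \<tau>))"
      unfolding s_def powr_diff using \<tau> by simp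
    then show ?thesis
      using has_real_derivative_powr[OF \<tau>, of "- 1 / r"] unfolding s_def by (simp only:)
  qed
  obtain X Y where
    X: "(emden_sigma l f has_real_derivative X / s \<tau>) (at (s \<tau>))"
      "((- g (s \<tau>) - 1)\<^sup>2 - (emden_sigma l f (s \<tau>))\<^sup>2) * X = - Delta2 (real DIM('a)) l r (emden_sigma l f (s \<tau>)) (- g (s \<tau>))"
    and Y: "(g has_real_derivative - Y / s \<tau>) (at (s \<tau>))"
      "((- g (s \<tau>) - 1)\<^sup>2 - (emden_sigma l f (s \<tau>))\<^sup>2) * Y = - Delta1 (real DIM('a)) l r (emden_sigma l f (s \<tau>)) (- g (s \<tau>))"
    by (rule emden_system[OF eq \<gamma> l smooth f g s pos])
  have S: "emden_sigma l f (s \<tau>) = \<tau> * S \<tau>" and V: "- g (s \<tau>) = \<tau> * V \<tau>"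
    using \<tau> by (auto simp: S_def V_def s_def)
  have N: "(- g (s \<tau>) - 1)\<^sup>2 - (emden_sigma l f (s \<tau>))\<^sup>2 = far_den \<tau> (S \<tau>) (V \<tau>)"
    unfolding S V far_den_def by (simp add: power2_commute)
  have X': "X = - Delta2 (real DIM('a)) l r (\<tau> * S \<tau>) (\<tau> * V \<tau>) / far_den \<tau> (S \<tau>) (V \<tau>)"
    using X(2) den unfolding N unfolding S V by (simp add: field_simps)
  have Y': "Y = - Delta1 (real DIM('a)) l r (\<tau> * S \<tau>) (\<tau> * V \<tau>) / far_den \<tau> (S \<tau>) (V \<tau>)"
    using Y(2) den unfolding N unfolding S V by (simp add: field_simps)
  note alg = far_algebra[of l "real DIM('a)" r \<tau> "S \<tau>" "V \<tau>", folded X' Y', symmetric]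
  have "((\<lambda>\<tau>. emden_sigma l f (s \<tau>)) has_real_derivative X / s \<tau> * - (s \<tau> / (r * \<tau>))) (at \<tau>)"
    by (rule DERIV_chain2[OF X(1) s'])
  from DERIV_divide[OF this DERIV_ident] \<tau>
  have "(S has_real_derivative (X / s \<tau> * - (s \<tau> / (r * \<tau>)) * \<tau> - emden_sigma l f (s \<tau>) * 1) / (\<tau> * \<tau>)) (at \<tau>)"
    unfolding S_def s_def by simp
  also have "(X / s \<tau> * - (s \<tau> / (r * \<tau>)) * \<tau> - emden_sigma l f (s \<tau>) * 1) / (\<tau> * \<tau>) = - (X + r * (\<tau> * S \<tau>)) / (r * \<tau>\<^sup>2)"
    unfolding S using s \<tau> r by (simp add: field_simps power2_eq_square)
  also have "\<dots> = far_S' (real DIM('a)) l r \<tau> (S \<tau>) (V \<tau>)"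
    using alg(1) l r \<tau> den by simp
  finally show "(S has_real_derivative far_S' (real DIM('a)) l r \<tau> (S \<tau>) (V \<tau>)) (at \<tau>)" .
  have "((\<lambda>\<tau>. - g (s \<tau>)) has_real_derivative - (- Y / s \<tau> * - (s \<tau> / (r * \<tau>)))) (at \<tau>)"
    by (rule DERIV_minus[OF DERIV_chain2[OF Y(1) s']])
  from DERIV_divide[OF this DERIV_ident] \<tau>
  have "(V has_real_derivative (- (- Y / s \<tau> * - (s \<tau> / (r * \<tau>))) * \<tau> - (- g (s \<tau>)) * 1) / (\<tau> * \<tau>)) (at \<tau>)"
    unfolding V_def s_def by simp
  also have "(- (- Y / s \<tau> * - (s \<tau> / (r * \<tau>))) * \<tau> - (- g (s \<tau>)) * 1) / (\<tau> * \<tau>) = - (Y + r * (\<tau> * V \<tau>)) / (r * \<tau>\<^sup>2)"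
    unfolding V using s \<tau> r by (simp add: field_simps power2_eq_square)
  also have "\<dots> = far_V' (real DIM('a)) l r \<tau> (S \<tau>) (V \<tau>)"
    using alg(2) l r \<tau> den by simp
  finally show "(V has_real_derivative far_V' (real DIM('a)) l r \<tau> (S \<tau>) (V \<tau>)) (at \<tau>)" .
qed

text \<open>
  Boundedness of \<open>(S, V)\<close> makes the derivatives bounded, so limits at \<open>0\<close> exist, and the extension by
  these limits is a solution on a closed interval to which bootstrapping applies. The limit of \<open>S\<close> is
  positive because \<open>ln S\<close> has a bounded derivative, hence a finite limit.
\<close>

lemma far_ode_smooth_extension:
  fixes S V :: "real \<Rightarrow> real"
  assumes r: "r > 0"
    and S: "\<And>\<tau>. \<tau> > 0 \<Longrightarrow> far_den \<tau> (S \<tau>) (V \<tau>) \<noteq> 0 \<Longrightarrow> (S has_real_derivative far_S' d l r \<tau> (S \<tau>) (V \<tau>)) (at \<tau>)"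
    and V: "\<And>\<tau>. \<tau> > 0 \<Longrightarrow> far_den \<tau> (S \<tau>) (V \<tau>) \<noteq> 0 \<Longrightarrow> (V has_real_derivative far_V' d l r \<tau> (S \<tau>) (V \<tau>)) (at \<tau>)"
    and pos: "\<And>\<tau>. \<tau> > 0 \<Longrightarrow> S \<tau> > 0"
    and lim: "((\<lambda>t. t * S t) \<longlongrightarrow> 0) (at_right 0)" "((\<lambda>t. t * V t) \<longlongrightarrow> 0) (at_right 0)"
  obtains b S1 V1 where "b > 0" "\<forall>k. Ck_on k {0..b} S1 \<and> Ck_on k {0..b} V1"
    "S1 0 > 0" "\<forall>\<tau>>0. S1 \<tau> = S \<tau> \<and> V1 \<tau> = V \<tau>"
proof -
  obtain C where C: "C > 0" and bnd: "\<And>\<tau> S V. 0 \<le> \<tau> \<Longrightarrow> \<tau> \<le> 1 \<Longrightarrow> \<bar>\<tau> * S\<bar> \<le> 1 / 4 \<Longrightarrow> \<bar>\<tau> * V\<bar> \<le> 1 / 4 \<Longrightarrow>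
      1 / 2 \<le> far_den \<tau> S V \<and>
      \<bar>far_S' d l r \<tau> S V\<bar> \<le> C * (S\<^sup>2 + V\<^sup>2) \<and> \<bar>far_V' d l r \<tau> S V\<bar> \<le> C * (S\<^sup>2 + V\<^sup>2)
      \<and> \<bar>far_S' d l r \<tau> S V\<bar> \<le> \<bar>S\<bar> * (C * (1 + \<bar>S\<bar> + \<bar>V\<bar>))"
    using far_bounds[OF r] by metis
  have "\<forall>\<^sub>F t in at_right 0. \<bar>t * S t\<bar> < 1 / 4 \<and> \<bar>t * V t\<bar> < 1 / 4 \<and> t < 1"
    using tendstoD[OF lim(1), of "1 / 4"] tendstoD[OF lim(2), of "1 / 4"]
      eventually_at_right_real[of 0 1] by (auto simp: eventually_conj_iff elim: eventually_mono)
  then obtain b0 where b0: "b0 > 0" "\<And>t. 0 < t \<Longrightarrow> t < b0 \<Longrightarrow> \<bar>t * S t\<bar> < 1 / 4 \<and> \<bar>t * V t\<bar> < 1 / 4 \<and> t < 1"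
    unfolding eventually_at_right_field by auto
  \<comment> \<open>a closed interval on which the strict bounds persist\<close>
  define t0 where "t0 = b0 / 2"
  have t0: "t0 > 0" using b0 by (simp add: t0_def)
  have near: "1 / 2 \<le> far_den t (S t) (V t)"
    "\<bar>far_S' d l r t (S t) (V t)\<bar> \<le> C * ((S t)\<^sup>2 + (V t)\<^sup>2)"
    "\<bar>far_V' d l r t (S t) (V t)\<bar> \<le> C * ((S t)\<^sup>2 + (V t)\<^sup>2)"
    "\<bar>far_S' d l r t (S t) (V t)\<bar> \<le> \<bar>S t\<bar> * (C * (1 + \<bar>S t\<bar> + \<bar>V t\<bar>))"
    if "t \<in> {0<..t0}" for t
    using bnd[of t "S t" "V t"] b0(2)[of t] that t0 by (auto simp: t0_def)
  have S': "(S has_real_derivative far_S' d l r t (S t) (V t)) (at t)"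
    and V': "(V has_real_derivative far_V' d l r t (S t) (V t)) (at t)" if "t \<in> {0<..t0}" for t
    using S[of t] V[of t] near(1)[OF that] that by auto
  obtain b M where b: "b \<in> {0<..t0}" and M: "\<And>t. t \<in> {0<..b} \<Longrightarrow> \<bar>S t\<bar> \<le> M \<and> \<bar>V t\<bar> \<le> M"
    using quadratic_growth_bounded[OF t0 C S' V' near(2,3) _ lim] pos by auto
  have sub: "t \<in> {0<..t0}" if "t \<in> {0<..b}" for t using that b by auto
  have b0': "b > 0" using b by auto
  have K: "C * ((S t)\<^sup>2 + (V t)\<^sup>2) \<le> C * (M\<^sup>2 + M\<^sup>2)" if "t \<in> {0<..b}" for t
    using M[OF that] C by (intro mult_left_mono add_mono abs_le_square_iff[THEN iffD1]) auto
  obtain LS where LS: "(S \<longlongrightarrow> LS) (at_right 0)"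
    using bounded_derivative_limit_at_right[of b S, OF S'[OF sub] b0' order_trans[OF near(2)[OF sub] K]] by blast
  obtain LV where LV: "(V \<longlongrightarrow> LV) (at_right 0)"
    using bounded_derivative_limit_at_right[of b V, OF V'[OF sub] b0' order_trans[OF near(3)[OF sub] K]] by blast
  have lnS: "((\<lambda>t. ln (S t)) has_real_derivative 1 / S t * far_S' d l r t (S t) (V t)) (at t)" 
    "\<bar>1 / S t * far_S' d l r t (S t) (V t)\<bar> \<le> C * (1 + M + M)" if t: "t \<in> {0<..b}" for t
  proof -
    have S0: "S t > 0" using pos t by auto
    show "((\<lambda>t. ln (S t)) has_real_derivative 1 / S t * far_S' d l r t (S t) (V t)) (at t)"
      using DERIV_chain2[OF DERIV_ln_divide[OF S0] S'[OF sub[OF t]]] .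
    have "\<bar>far_S' d l r t (S t) (V t)\<bar> \<le> \<bar>S t\<bar> * (C * (1 + \<bar>S t\<bar> + \<bar>V t\<bar>))"
      by (rule near(4)[OF sub[OF t]])
    also have "\<dots> \<le> \<bar>S t\<bar> * (C * (1 + M + M))"
      using M[OF t] C by (intro mult_left_mono) auto
    finally show "\<bar>1 / S t * far_S' d l r t (S t) (V t)\<bar> \<le> C * (1 + M + M)"
      using S0 by (simp add: abs_mult pos_divide_le_eq mult.commute)
  qed
  obtain L where L: "((\<lambda>t. ln (S t)) \<longlongrightarrow> L) (at_right 0)"
    by (rule bounded_derivative_limit_at_right[OF lnS(1) b0' lnS(2)])
  have "((\<lambda>t. exp (ln (S t))) \<longlongrightarrow> exp L) (at_right 0)"
    by (rule tendsto_exp[OF L])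
  moreover have "\<forall>\<^sub>F t in at_right 0. exp (ln (S t)) = S t"
    using eventually_at_right_less[of 0] by eventually_elim (use pos in simp)
  ultimately have "(S \<longlongrightarrow> exp L) (at_right 0)"
    by (rule Lim_transform_eventually)
  then have LS0: "LS > 0"
    using tendsto_unique[OF trivial_limit_at_right_real LS] exp_gt_zero[of L] by metis
  define S1 where "S1 t = (if t = 0 then LS else S t)" for t
  define V1 where "V1 t = (if t = 0 then LV else V t)" for t
  have cont: "continuous_on {0..b} \<phi>" if "(f \<longlongrightarrow> L) (at_right 0)" 
      "\<And>t. t \<in> {0<..b} \<Longrightarrow> (f has_real_derivative f' t) (at t)"
      "\<And>t. \<phi> t = (if t = 0 then L else f t)" for f f' \<phi> L
    unfolding continuous_on
  proof
    fix t assume t: "t \<in> {0..b}"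
    show "(\<phi> \<longlongrightarrow> \<phi> t) (at t within {0..b})"
    proof (cases "t = 0")
      case True
      have "(\<phi> \<longlongrightarrow> L) (at_right 0)"
        using that(1) by (rule Lim_transform_eventually)
          (use that(3) in \<open>auto simp: eventually_at_topological\<close>)
      moreover have "at 0 within {0..b} = at_right 0"
        using b0' by (intro at_within_nhd[of _ "{..<b}"]) auto
      ultimately show ?thesis using True that(3) by simp
    next
      case False
      then have "f \<midarrow>t\<rightarrow> f t" using that(2)[of t] t DERIV_isCont by (auto simp: isCont_def)
      then have "\<phi> \<midarrow>t\<rightarrow> f t"
        by (rule Lim_transform_within_open[of _ _ _ _ "{0<..}"]) (use that(3) t False in auto)
      then show ?thesis using False that(3) by (auto intro: tendsto_within_subset)
    qed
  qed
  have contS: "continuous_on {0..b} S1"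
    by (rule cont[OF LS S'[OF sub]]) (auto simp: S1_def)
  have contV: "continuous_on {0..b} V1"
    by (rule cont[OF LV V'[OF sub]]) (auto simp: V1_def)
  have den: "far_den t (S1 t) (V1 t) > 0" if "t \<in> {0..b}" for t
  proof (cases "t = 0")
    case False
    then show ?thesis using near(1)[of t] sub[of t] that by (auto simp: S1_def V1_def)
  qed (simp add: far_den_def)
  have Ck: "Ck_on k {0..b} (\<lambda>t. far_S' d l r t (S1 t) (V1 t)) \<and> Ck_on k {0..b} (\<lambda>t. far_V' d l r t (S1 t) (V1 t))"
    if "Ck_on k {0..b} S1" "Ck_on k {0..b} V1" for k
    using that den r by (rule far_ode_Ck)
  have contF: "continuous_on {0..b} (\<lambda>t. far_S' d l r t (S1 t) (V1 t))"
     "continuous_on {0..b} (\<lambda>t. far_V' d l r t (S1 t) (V1 t))"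
    using Ck[of 0] contS contV by auto
  have derS: "(S1 has_real_derivative far_S' d l r t (S1 t) (V1 t)) (at t within {0..b})" if t: "t \<in> {0..b}" for t
  proof (rule derivative_extends_to_endpoint[OF b0' contS contF(1) _ t])
    fix t assume t: "t \<in> {0<..b}"
    have "(S1 has_real_derivative far_S' d l r t (S t) (V t)) (at t)"
      by (rule has_field_derivative_transform_within_open[OF S'[OF sub[OF t]], of "{0<..}"])
         (use t in \<open>auto simp: S1_def\<close>)
    then show "(S1 has_real_derivative far_S' d l r t (S1 t) (V1 t)) (at t within {0..b})"
      using t by (auto simp: S1_def V1_def intro: has_field_derivative_at_within)
  qed
  have derV: "(V1 has_real_derivative far_V' d l r t (S1 t) (V1 t)) (at t within {0..b})" if t: "t \<in> {0..b}" for t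
  proof (rule derivative_extends_to_endpoint[OF b0' contV contF(2) _ t])
    fix t assume t: "t \<in> {0<..b}"
    have "(V1 has_real_derivative far_V' d l r t (S t) (V t)) (at t)"
      by (rule has_field_derivative_transform_within_open[OF V'[OF sub[OF t]], of "{0<..}"])
         (use t in \<open>auto simp: V1_def\<close>)
    then show "(V1 has_real_derivative far_V' d l r t (S1 t) (V1 t)) (at t within {0..b})"
      using t by (auto simp: S1_def V1_def intro: has_field_derivative_at_within)
  qed
  have "Ck_on k {0..b} S1 \<and> Ck_on k {0..b} V1" for k
    by (rule ode_solution_Ck[OF derS derV Ck])
  then show ?thesis
    by (intro that[of b S1 V1] b0') (auto simp: S1_def V1_def LS0)
qed

text \<open>
  The far field of a profile, expressed by functions \<open>S\<close> and \<open>V\<close> that are smooth up to \<open>\<tau> = 0\<close>. Beyond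
  \<open>b\<close>, the sonic line \<open>\<Delta> = 0\<close> may be crossed, and the differential equation gives no information;
  the representation itself still holds, as it only rewrites \<open>\<rho>\<close> and \<open>u\<close>.
\<close>

lemma global_profile_far_field:
  fixes \<rho> :: "'a::euclidean_space \<Rightarrow> real" and u :: "'a \<Rightarrow> 'a"
  assumes prof: "global_smooth_profile \<gamma> l r \<rho> u" and \<gamma>: "\<gamma> = 1 + 2 / l" and l: "l > 0" and r: "r > 0"
  obtains b S V where "b > 0" "\<forall>k. Ck_on k {0..b} S \<and> Ck_on k {0..b} V"
    "\<forall>\<tau>\<ge>0. S \<tau> > 0"
    "\<forall>Z. Z \<noteq> 0 \<longrightarrow> \<rho> Z = (sqrt (l / 2) * norm Z powr (1 - r) * S (norm Z powr (- r))) powr l"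
    "\<forall>Z. Z \<noteq> 0 \<longrightarrow> u Z = - (norm Z powr (- r) * V (norm Z powr (- r))) *\<^sub>R Z"
proof -
  have smooth: "smooth_on UNIV \<rho>" "smooth_on UNIV u" and pos: "\<And>Z. \<rho> Z > 0"
    and eq: "stationary_euler \<gamma> l r \<rho> u"
    using prof unfolding global_smooth_profile_def by auto
  obtain f g where f: "\<And>Z. \<rho> Z = f (norm Z)" and g: "\<And>Z. u Z = g (norm Z) *\<^sub>R Z"
    using prof unfolding global_smooth_profile_def spherically_symmetric_def by auto
  obtain \<sigma> w where em: "emden_variables \<gamma> l \<rho> u \<sigma> w" and \<sigma>: "(\<sigma> \<longlongrightarrow> 0) at_top" and w: "(w \<longlongrightarrow> 0) at_top"
    using prof unfolding global_smooth_profile_def terminates_at_P4_def by auto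
  obtain e :: 'a where e: "e \<in> Basis" using nonempty_Basis by blast
  have fpos: "f s > 0" if "s > 0" for s
    using pos[of "s *\<^sub>R e"] f[of "s *\<^sub>R e"] e that by simp
  have em': "emden_sigma l f s = \<sigma> (ln s)" "- g s = w (ln s)" if s: "s > 0" for s
  proof -
    have Z: "s *\<^sub>R e \<noteq> 0" "norm (s *\<^sub>R e) = s" using s e by auto
    have "\<rho> (s *\<^sub>R e) powr ((\<gamma> - 1) / 2) = sqrt (l / 2) * s * \<sigma> (ln s)" and
      u: "u (s *\<^sub>R e) = - (w (ln s) *\<^sub>R (s *\<^sub>R e))"
      using em[unfolded emden_variables_def, rule_format, OF Z(1)] unfolding Z(2) by auto
    then show "emden_sigma l f s = \<sigma> (ln s)"
      using f[of "s *\<^sub>R e"] s l unfolding Z(2) by (simp add: emden_sigma_def \<gamma>)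
    have "(g s + w (ln s)) *\<^sub>R (s *\<^sub>R e) = 0"
      using u g[of "s *\<^sub>R e"] unfolding Z(2) by (simp only: scaleR_add_left) simp
    then show "- g s = w (ln s)" using Z(1) by simp
  qed
  define S where "S = (\<lambda>\<tau>. emden_sigma l f (\<tau> powr (- 1 / r)) / \<tau>)"
  define V where "V = (\<lambda>\<tau>. - g (\<tau> powr (- 1 / r)) / \<tau>)"
  have ode: "(S has_real_derivative far_S' (real DIM('a)) l r \<tau> (S \<tau>) (V \<tau>)) (at \<tau>)"
    "(V has_real_derivative far_V' (real DIM('a)) l r \<tau> (S \<tau>) (V \<tau>)) (at \<tau>)"
    if "\<tau> > 0" "far_den \<tau> (S \<tau>) (V \<tau>) \<noteq> 0" for \<tau>
    using profile_far_ode[OF eq \<gamma> l r smooth f g _ that[unfolded S_def V_def]] fpos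
    unfolding S_def V_def by blast+
  have Spos: "S \<tau> > 0" if "\<tau> > 0" for \<tau>
    using that fpos[of "\<tau> powr (- 1 / r)"] l by (simp add: S_def emden_sigma_def)
  have top: "filterlim (\<lambda>\<tau>::real. ln (\<tau> powr (- 1 / r))) at_top (at_right 0)"
  proof -
    have "filterlim (\<lambda>\<tau>::real. (1 / r) * (- ln \<tau>)) at_top (at_right 0)"
      using r ln_at_0 by (intro filterlim_tendsto_pos_mult_at_top[OF tendsto_const])
        (auto simp: filterlim_uminus_at_bot)
    moreover have "\<forall>\<^sub>F \<tau>::real in at_right 0. (1 / r) * (- ln \<tau>) = ln (\<tau> powr (- 1 / r))"
      using eventually_at_right_less[of 0] by eventually_elim (simp add: ln_powr)
    ultimately show ?thesis by (rule filterlim_cong[THEN iffD1, OF refl refl, rotated])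
  qed
  have limS: "((\<lambda>t. t * S t) \<longlongrightarrow> 0) (at_right 0)"
  proof (rule Lim_transform_eventually[OF filterlim_compose[OF \<sigma> top]])
    show "\<forall>\<^sub>F t in at_right 0. \<sigma> (ln (t powr (- 1 / r))) = t * S t"
      using eventually_at_right_less[of 0] by eventually_elim (simp add: S_def em')
  qed
  have limV: "((\<lambda>t. t * V t) \<longlongrightarrow> 0) (at_right 0)"
  proof (rule Lim_transform_eventually[OF filterlim_compose[OF w top]])
    show "\<forall>\<^sub>F t in at_right 0. w (ln (t powr (- 1 / r))) = t * V t"
      using eventually_at_right_less[of 0] by eventually_elim (simp add: V_def em')
  qed
  obtain b S1 V1 where b: "b > 0" and Ck: "\<forall>k. Ck_on k {0..b} S1 \<and> Ck_on k {0..b} V1"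
    and S1: "S1 0 > 0" "\<forall>\<tau>>0. S1 \<tau> = S \<tau> \<and> V1 \<tau> = V \<tau>"
    by (rule far_ode_smooth_extension[OF r ode Spos limS limV])
  have inv: "(s powr (- r)) powr (- 1 / r) = s" if "s > 0" for s
    using that r by (simp add: powr_powr)
  show ?thesis
  proof (rule that[OF b Ck]; intro allI impI)
    show "S1 \<tau> > 0" if "\<tau> \<ge> 0" for \<tau>
      using that S1 Spos by (cases "\<tau> = 0") auto
    fix Z :: 'a assume Z: "Z \<noteq> 0"
    define s where "s = norm Z"
    have s: "s > 0" using Z by (simp add: s_def)
    have "S1 (s powr (- r)) = S (s powr (- r))" "V1 (s powr (- r)) = V (s powr (- r))"
      using S1(2) s by auto
    then have S1s: "S1 (s powr (- r)) = emden_sigma l f s / s powr (- r)"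
      and V1s: "V1 (s powr (- r)) = - g s / s powr (- r)"
      by (simp_all only: S_def V_def inv[OF s])
    have "sqrt (l / 2) * s powr (1 - r) * S1 (s powr (- r)) = f s powr (1 / l)"
      using s l unfolding S1s
      by (simp add: emden_sigma_def powr_diff powr_minus field_simps)
    then show "\<rho> Z = (sqrt (l / 2) * norm Z powr (1 - r) * S1 (norm Z powr (- r))) powr l"
      using f[of Z] l fpos[OF s] unfolding s_def[symmetric] by (simp add: powr_powr)
    have "s powr (- r) * V1 (s powr (- r)) = - g s"
      using s unfolding V1s by simp
    then show "u Z = - (norm Z powr (- r) * V1 (norm Z powr (- r))) *\<^sub>R Z"
      using g[of Z] unfolding s_def[symmetric] by simp
  qed
qed

section \<open>The self-similar ansatz\<close>

lemma grad_unique: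
  assumes "(f has_derivative (\<lambda>v. G \<bullet> v)) (at x)"
  shows "grad f x = G"
  unfolding grad_def frechet_derivative_at[OF assms, symmetric] by (rule euclidean_representation)

lemma has_derivative_grad:
  assumes "f differentiable (at x)"
  shows "(f has_derivative (\<lambda>v. grad f x \<bullet> v)) (at x)"
proof -
  have D: "(f has_derivative frechet_derivative f (at x)) (at x)"
    using assms by (simp add: frechet_derivative_works)
  have "frechet_derivative f (at x) v = grad f x \<bullet> v" for v
  proof -
    have "frechet_derivative f (at x) v = frechet_derivative f (at x) (\<Sum>b\<in>Basis. (v \<bullet> b) *\<^sub>R b)"
      by (simp add: euclidean_representation)
    also have "\<dots> = (\<Sum>b\<in>Basis. (v \<bullet> b) * frechet_derivative f (at x) b)"
      using has_derivative_linear[OF D] by (simp add: linear_sum linear_scale)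
    also have "\<dots> = grad f x \<bullet> v"
      by (simp add: grad_def inner_sum_left inner_commute[of v] mult.commute)
    finally show ?thesis .
  qed
  then show ?thesis using D by (metis (no_types, lifting) ext)
qed

text \<open>
  Write \<open>R = A(t) \<rho>(Z)\<close>, \<open>U = B(t) u(Z)\<close>, \<open>Z = c(t) y\<close> and \<open>s = T - t\<close>. The exponents are chosen such that
  \<open>B c = 1 / (r s)\<close> and \<open>A powr (\<gamma> - 1) = B\<^sup>2\<close>; then every term of the continuity equation is
  \<open>A / (r s)\<close> times the corresponding term of the stationary one, and every term of the momentum
  equation is \<open>A \<rho> B / (r s)\<close> times the corresponding one.
\<close>

lemma selfsimilar_euler_solution:
  fixes \<rho> :: "'a::euclidean_space \<Rightarrow> real" and u :: "'a \<Rightarrow> 'a"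
    and R :: "real \<times> 'a \<Rightarrow> real" and U :: "real \<times> 'a \<Rightarrow> 'a"
  assumes eq: "stationary_euler \<gamma> l r \<rho> u" and \<gamma>: "\<gamma> = 1 + 2 / l" and l: "l > 0" and r: "r > 0"
    and diff: "\<And>Z. \<rho> differentiable (at Z)" "\<And>Z. u differentiable (at Z)"
    and pos: "\<And>Z. \<rho> Z > 0"
    and R: "\<And>t y. t < T \<Longrightarrow> R (t, y) = 1 / (T - t) powr (2 * (r - 1) / (r * (\<gamma> - 1))) * \<rho> (selfsim_var r T r (t, y))"
    and U: "\<And>t y. t < T \<Longrightarrow> U (t, y) = (1 / (T - t) powr ((r - 1) / r)) *\<^sub>R u (selfsim_var r T r (t, y))"
  shows "euler_solution \<gamma> T R U"
  unfolding euler_solution_def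
proof (intro allI impI)
  fix t :: real and y :: 'a assume t: "t < T"
  define s where "s = T - t"
  define \<alpha> where "\<alpha> = 2 * (r - 1) / (r * (\<gamma> - 1))"
  define \<beta> where "\<beta> = (r - 1) / r"
  define A where "A = (\<lambda>t. 1 / (T - t) powr \<alpha>)"
  define B where "B = (\<lambda>t. 1 / (T - t) powr \<beta>)"
  define c where "c = (\<lambda>t. 1 / (r * (T - t) powr (1 / r)))"
  define Z where "Z = c t *\<^sub>R y"
  have s: "s > 0" using t by (simp add: s_def)
  have R': "R (t, y) = A t * \<rho> (c t *\<^sub>R y)" and U': "U (t, y) = B t *\<^sub>R u (c t *\<^sub>R y)" if "t < T" for t y
    using R[OF that] U[OF that] by (auto simp: selfsim_var_def A_def B_def c_def \<alpha>_def \<beta>_def)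
  have Apos: "A t > 0" using t by (simp add: A_def)
  have \<alpha>r: "\<alpha> * r = l * (r - 1)" using l r by (simp add: \<alpha>_def \<gamma> field_simps)
  \<comment> \<open>this identity is where the choice of r as the length scale enters\<close>
  have Bc: "B t * c t = 1 / (r * s)"
  proof -
    have "s powr \<beta> * s powr (1 / r) = s"
      using s r by (simp add: \<beta>_def field_simps flip: powr_add)
    then have "s powr \<beta> * (r * s powr (1 / r)) = r * s" by (simp add: mult_ac)
    then show ?thesis unfolding B_def c_def s_def by simp
  qed
  \<comment> \<open>balances the pressure gradient against the inertial terms\<close>
  have AB: "A t powr (\<gamma> - 1) = (B t)\<^sup>2"
  proof -
    have "A t powr (\<gamma> - 1) = 1 / s powr (\<alpha> * (\<gamma> - 1))"
      by (simp add: A_def s_def powr_divide powr_powr)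
    also have "\<alpha> * (\<gamma> - 1) = \<beta> + \<beta>"
      using l r by (simp add: \<alpha>_def \<beta>_def \<gamma> field_simps)
    also have "1 / s powr (\<beta> + \<beta>) = (B t)\<^sup>2"
      unfolding powr_add B_def s_def power2_eq_square by simp
    finally show ?thesis .
  qed
  have power': "((\<lambda>t. 1 / (T - t) powr a) has_real_derivative a * (1 / (T - t) powr a) / s) (at t)" for a
  proof -
    have "((\<lambda>t. (T - t) powr (- a)) has_real_derivative (- a * (T - t) powr (- a - 1)) * (0 - 1)) (at t)"
      using t by (intro DERIV_chain2[OF has_real_derivative_powr] derivative_intros) auto
    moreover have "(- a * (T - t) powr (- a - 1)) * (0 - 1) = a * (1 / (T - t) powr a) / s"
      unfolding powr_diff using t by (simp add: s_def powr_minus_divide)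
    ultimately show ?thesis by (simp add: powr_minus_divide)
  qed
  have A': "(A has_real_derivative \<alpha> * A t / s) (at t)"
    using power' unfolding A_def .
  have B': "(B has_real_derivative \<beta> * B t / s) (at t)"
    using power' unfolding B_def .
  have c': "(c has_real_derivative c t / (r * s)) (at t)"
  proof -
    have "((\<lambda>t. 1 / r * (1 / (T - t) powr (1 / r))) has_real_derivative 1 / r * (1 / r * (1 / (T - t) powr (1 / r)) / s)) (at t)"
      by (rule DERIV_cmult[OF power'])
    then show ?thesis by (simp add: c_def mult_ac)
  qed
  define D\<rho> where "D\<rho> = frechet_derivative \<rho> (at Z)"
  define Du where "Du = frechet_derivative u (at Z)"
  have D\<rho>: "(\<rho> has_derivative D\<rho>) (at Z)" and Du: "(u has_derivative Du) (at Z)"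
    using diff by (auto simp: D\<rho>_def Du_def frechet_derivative_works)
  have linD: "linear D\<rho>" "linear Du" using D\<rho> Du has_derivative_linear by blast+
  have path: "((\<lambda>t. c t *\<^sub>R y) has_derivative (\<lambda>h. (h * (c t / (r * s))) *\<^sub>R y)) (at t)"
    using has_derivative_scaleR_left[OF c'[unfolded has_field_derivative_def]] by (simp add: mult_ac)
  have dil: "((\<lambda>z. c t *\<^sub>R z) has_derivative (\<lambda>v. c t *\<^sub>R v)) (at y)"
    by (intro derivative_intros)
  have Z1: "(c t / (r * s)) *\<^sub>R y = (1 / (r * s)) *\<^sub>R Z" by (simp add: Z_def)
  have tR: "vector_derivative (\<lambda>s. R (s, y)) (at t) = A t / (r * s) * (l * (r - 1) * \<rho> Z + D\<rho> Z)"
  proof (rule vector_derivative_at)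
    have "((\<lambda>t. \<rho> (c t *\<^sub>R y)) has_derivative (\<lambda>h. D\<rho> ((h * (c t / (r * s))) *\<^sub>R y))) (at t)"
      using diff_chain_at[OF path D\<rho>[unfolded Z_def]] by (simp add: o_def)
    moreover have "D\<rho> ((h * (c t / (r * s))) *\<^sub>R y) = (1 / (r * s) * D\<rho> Z) * h" for h
    proof -
      have "(h * (c t / (r * s))) *\<^sub>R y = (h / (r * s)) *\<^sub>R Z" by (simp add: Z_def)
      then show ?thesis by (simp add: linear_scale[OF linD(1)])
    qed
    ultimately have "((\<lambda>t. \<rho> (c t *\<^sub>R y)) has_real_derivative 1 / (r * s) * D\<rho> Z) (at t)"
      unfolding has_field_derivative_def by (elim has_derivative_eq_rhs) (auto simp only: fun_eq_iff)
    from DERIV_mult[OF A' this]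
    have "((\<lambda>t. A t * \<rho> (c t *\<^sub>R y)) has_real_derivative \<alpha> * A t / s * \<rho> Z + 1 / (r * s) * D\<rho> Z * A t) (at t)"
      by (simp add: Z_def)
    moreover have "\<alpha> * A t / s * \<rho> Z + 1 / (r * s) * D\<rho> Z * A t = A t / (r * s) * (l * (r - 1) * \<rho> Z + D\<rho> Z)"
      unfolding \<alpha>r[symmetric] using r s by (simp add: field_simps)
    ultimately have "((\<lambda>t. A t * \<rho> (c t *\<^sub>R y)) has_vector_derivative A t / (r * s) * (l * (r - 1) * \<rho> Z + D\<rho> Z)) (at t)"
      by (simp add: has_real_derivative_iff_has_vector_derivative)
    then show "((\<lambda>s. R (s, y)) has_vector_derivative A t / (r * s) * (l * (r - 1) * \<rho> Z + D\<rho> Z)) (at t)"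
      by (rule has_vector_derivative_transform_within_open[of _ _ _ "{..<T}"]) (use t R' in auto)
  qed
  have tU: "vector_derivative (\<lambda>s. U (s, y)) (at t) = (B t / (r * s)) *\<^sub>R ((r - 1) *\<^sub>R u Z + Du Z)"
  proof (rule vector_derivative_at)
    have "((\<lambda>t. u (c t *\<^sub>R y)) has_derivative (\<lambda>h. Du ((h * (c t / (r * s))) *\<^sub>R y))) (at t)"
      using diff_chain_at[OF path Du[unfolded Z_def]] by (simp add: o_def)
    moreover have "Du ((h * (c t / (r * s))) *\<^sub>R y) = h *\<^sub>R ((1 / (r * s)) *\<^sub>R Du Z)" for h
    proof -
      have "(h * (c t / (r * s))) *\<^sub>R y = (h / (r * s)) *\<^sub>R Z" by (simp add: Z_def)
      then show ?thesis by (simp add: linear_scale[OF linD(2)])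
    qed
    ultimately have "((\<lambda>t. u (c t *\<^sub>R y)) has_vector_derivative (1 / (r * s)) *\<^sub>R Du Z) (at t)"
      unfolding has_vector_derivative_def by (elim has_derivative_eq_rhs) (auto simp only: fun_eq_iff)
    from has_vector_derivative_scaleR[OF B' this]
    have "((\<lambda>t. B t *\<^sub>R u (c t *\<^sub>R y)) has_vector_derivative B t *\<^sub>R ((1 / (r * s)) *\<^sub>R Du Z) + (\<beta> * B t / s) *\<^sub>R u Z) (at t)"
      by (simp add: Z_def)
    moreover have "B t *\<^sub>R ((1 / (r * s)) *\<^sub>R Du Z) + (\<beta> * B t / s) *\<^sub>R u Z = (B t / (r * s)) *\<^sub>R ((r - 1) *\<^sub>R u Z + Du Z)"
      using r s by (simp add: \<beta>_def scaleR_add_right mult_ac)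
    ultimately have "((\<lambda>t. B t *\<^sub>R u (c t *\<^sub>R y)) has_vector_derivative (B t / (r * s)) *\<^sub>R ((r - 1) *\<^sub>R u Z + Du Z)) (at t)"
      by simp
    then show "((\<lambda>s. U (s, y)) has_vector_derivative (B t / (r * s)) *\<^sub>R ((r - 1) *\<^sub>R u Z + Du Z)) (at t)"
      by (rule has_vector_derivative_transform_within_open[of _ _ _ "{..<T}"]) (use t U' in auto)
  qed
  have div: "divergence (\<lambda>z. R (t, z) *\<^sub>R U (t, z)) y = A t / (r * s) * divergence (\<lambda>z. \<rho> z *\<^sub>R u z) Z"
  proof -
    define DP where "DP = frechet_derivative (\<lambda>z. \<rho> z *\<^sub>R u z) (at Z)"
    have DP: "((\<lambda>z. \<rho> z *\<^sub>R u z) has_derivative DP) (at Z)"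
      using has_derivative_scaleR[OF D\<rho> Du] unfolding DP_def
      by (metis differentiable_def frechet_derivative_works)
    have lin: "linear DP" using DP has_derivative_linear by blast
    have "((\<lambda>z. (A t * B t) *\<^sub>R (\<rho> (c t *\<^sub>R z) *\<^sub>R u (c t *\<^sub>R z))) has_derivative (\<lambda>v. (A t * B t) *\<^sub>R DP (c t *\<^sub>R v))) (at y)"
      using has_derivative_scaleR_right[OF diff_chain_at[OF dil DP[unfolded Z_def]]] by (simp add: o_def)
    moreover have "(\<lambda>z. (A t * B t) *\<^sub>R (\<rho> (c t *\<^sub>R z) *\<^sub>R u (c t *\<^sub>R z))) = (\<lambda>z. R (t, z) *\<^sub>R U (t, z))"
      using R'[OF t] U'[OF t] by (auto simp: mult_ac)
    moreover have "(A t * B t) *\<^sub>R DP (c t *\<^sub>R v) = (A t / (r * s)) *\<^sub>R DP v" for v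
      using Bc by (simp add: linear_scale[OF lin] mult.assoc)
    ultimately have "((\<lambda>z. R (t, z) *\<^sub>R U (t, z)) has_derivative (\<lambda>v. (A t / (r * s)) *\<^sub>R DP v)) (at y)"
      by simp
    from frechet_derivative_at[OF this, symmetric] show ?thesis
      unfolding divergence_def DP_def[symmetric] by (simp add: sum_distrib_left)
  qed
  have dirU: "dir_deriv (U (t, y)) (\<lambda>z. U (t, z)) y = (B t / (r * s)) *\<^sub>R Du (u Z)"
  proof -
    have "((\<lambda>z. B t *\<^sub>R u (c t *\<^sub>R z)) has_derivative (\<lambda>v. B t *\<^sub>R Du (c t *\<^sub>R v))) (at y)"
      using has_derivative_scaleR_right[OF diff_chain_at[OF dil Du[unfolded Z_def]]] by (simp add: o_def)
    moreover have "(\<lambda>z. B t *\<^sub>R u (c t *\<^sub>R z)) = (\<lambda>z. U (t, z))"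
      using U'[OF t] by auto
    ultimately have "((\<lambda>z. U (t, z)) has_derivative (\<lambda>v. B t *\<^sub>R Du (c t *\<^sub>R v))) (at y)" by simp
    from frechet_derivative_at[OF this, symmetric]
    have "dir_deriv (U (t, y)) (\<lambda>z. U (t, z)) y = B t *\<^sub>R Du (c t *\<^sub>R (B t *\<^sub>R u Z))"
      unfolding dir_deriv_def U'[OF t] Z_def by simp
    also have "c t *\<^sub>R (B t *\<^sub>R u Z) = (1 / (r * s)) *\<^sub>R u Z"
      using Bc by (simp add: mult.commute)
    finally show ?thesis by (simp add: linear_scale[OF linD(2)])
  qed
  have gradP: "grad (\<lambda>z. pressure \<gamma> (R (t, z))) y = (R (t, y) * (B t / (r * s))) *\<^sub>R grad (\<lambda>z. \<rho> z powr (\<gamma> - 1)) Z"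
  proof -
    define G where "G = grad \<rho> Z"
    have G: "(\<rho> has_derivative (\<lambda>v. G \<bullet> v)) (at Z)"
      unfolding G_def by (rule has_derivative_grad[OF diff(1)])
    have "((\<lambda>x. x powr (\<gamma> - 1)) has_derivative (\<lambda>h. h * ((\<gamma> - 1) * \<rho> Z powr (\<gamma> - 2)))) (at (\<rho> Z))"
      using has_real_derivative_powr[OF pos[of Z], of "\<gamma> - 1"] by (simp add: has_field_derivative_def mult_commute_abs)
    from diff_chain_at[OF G this]
    have "((\<lambda>z. \<rho> z powr (\<gamma> - 1)) has_derivative (\<lambda>v. (((\<gamma> - 1) * \<rho> Z powr (\<gamma> - 2)) *\<^sub>R G) \<bullet> v)) (at Z)"
      by (simp add: o_def mult.commute)
    then have g1: "grad (\<lambda>z. \<rho> z powr (\<gamma> - 1)) Z = ((\<gamma> - 1) * \<rho> Z powr (\<gamma> - 2)) *\<^sub>R G"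
      by (rule grad_unique)
    have Rpos: "A t * \<rho> Z > 0" using Apos pos by simp
    have "((\<lambda>x. (\<gamma> - 1) / \<gamma> * x powr \<gamma>) has_real_derivative (\<gamma> - 1) / \<gamma> * (\<gamma> * (A t * \<rho> Z) powr (\<gamma> - 1))) (at (A t * \<rho> Z))"
      by (rule DERIV_cmult[OF has_real_derivative_powr[OF Rpos]])
    moreover have "\<gamma> \<noteq> 0" using l by (simp add: \<gamma> add_pos_pos less_imp_neq[symmetric])
    ultimately have "(pressure \<gamma> has_derivative (\<lambda>h. h * ((\<gamma> - 1) * (A t * \<rho> Z) powr (\<gamma> - 1)))) (at (A t * \<rho> Z))"
      unfolding has_field_derivative_def pressure_def[abs_def] by (simp add: mult_commute_abs)
    moreover have "((\<lambda>z. A t * \<rho> (c t *\<^sub>R z)) has_derivative (\<lambda>v. A t * (G \<bullet> (c t *\<^sub>R v)))) (at y)"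
      using has_derivative_mult_right[OF diff_chain_at[OF dil G[unfolded Z_def]]] by (simp add: o_def)
    ultimately have "((\<lambda>z. pressure \<gamma> (A t * \<rho> (c t *\<^sub>R z))) has_derivative
       (\<lambda>v. (A t * (G \<bullet> (c t *\<^sub>R v))) * ((\<gamma> - 1) * (A t * \<rho> Z) powr (\<gamma> - 1)))) (at y)"
      unfolding Z_def using diff_chain_at by (fastforce simp: o_def)
    then have "((\<lambda>z. pressure \<gamma> (R (t, z))) has_derivative
       (\<lambda>v. ((A t * c t * ((\<gamma> - 1) * (A t * \<rho> Z) powr (\<gamma> - 1))) *\<^sub>R G) \<bullet> v)) (at y)"
      unfolding R'[OF t] by (simp add: mult_ac)
    then have "grad (\<lambda>z. pressure \<gamma> (R (t, z))) y = (A t * c t * ((\<gamma> - 1) * (A t * \<rho> Z) powr (\<gamma> - 1))) *\<^sub>R G"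
      by (rule grad_unique)
    also have "A t * c t * ((\<gamma> - 1) * (A t * \<rho> Z) powr (\<gamma> - 1)) = R (t, y) * (B t / (r * s)) * ((\<gamma> - 1) * \<rho> Z powr (\<gamma> - 2))"
    proof -
      have "\<rho> Z powr (\<gamma> - 1) = \<rho> Z * \<rho> Z powr (\<gamma> - 2)"
        using pos[of Z] by (simp add: powr_diff power2_eq_square)
      moreover have "(A t * \<rho> Z) powr (\<gamma> - 1) = (B t)\<^sup>2 * \<rho> Z powr (\<gamma> - 1)"
        unfolding AB[symmetric] by (simp add: powr_mult)
      moreover have "B t / (r * s) = B t * (B t * c t)" using Bc by simp
      ultimately show ?thesis unfolding R'[OF t] Z_def[symmetric] by (simp add: power2_eq_square)
    qed
    finally show ?thesis unfolding g1 by simp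
  qed
  have E: "l * (r - 1) * \<rho> Z + D\<rho> Z + divergence (\<lambda>z. \<rho> z *\<^sub>R u z) Z = 0"
    "(r - 1) *\<^sub>R u Z + Du Z + Du (u Z) + grad (\<lambda>z. \<rho> z powr (\<gamma> - 1)) Z = 0"
    using eq unfolding stationary_euler_def dir_deriv_def D\<rho>_def Du_def by blast+
  have "vector_derivative (\<lambda>s. R (s, y)) (at t) + divergence (\<lambda>z. R (t, z) *\<^sub>R U (t, z)) y
     = A t / (r * s) * (l * (r - 1) * \<rho> Z + D\<rho> Z + divergence (\<lambda>z. \<rho> z *\<^sub>R u z) Z)"
    unfolding tR div by (simp only: distrib_left)
  moreover have "R (t, y) *\<^sub>R vector_derivative (\<lambda>s. U (s, y)) (at t)
       + R (t, y) *\<^sub>R dir_deriv (U (t, y)) (\<lambda>z. U (t, z)) y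
       + grad (\<lambda>z. pressure \<gamma> (R (t, z))) y
     = (R (t, y) * (B t / (r * s))) *\<^sub>R ((r - 1) *\<^sub>R u Z + Du Z + Du (u Z) + grad (\<lambda>z. \<rho> z powr (\<gamma> - 1)) Z)"
    unfolding tU dirU gradP by (simp only: scaleR_add_right scaleR_scaleR mult.assoc)
  moreover have "R (t, y) > 0" using R'[OF t] Apos pos by simp
  ultimately show "R (t, y) > 0 \<and>
       vector_derivative (\<lambda>s. R (s, y)) (at t) + divergence (\<lambda>z. R (t, z) *\<^sub>R U (t, z)) y = 0 \<and>
       R (t, y) *\<^sub>R vector_derivative (\<lambda>s. U (s, y)) (at t)
       + R (t, y) *\<^sub>R dir_deriv (U (t, y)) (\<lambda>z. U (t, z)) y
       + grad (\<lambda>z. pressure \<gamma> (R (t, z))) y = 0"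
    unfolding E by simp
qed

section \<open>Divergence of the energy\<close>

text \<open>
  At the borderline rate \<open>|y| powr (- d)\<close>, each dyadic shell contributes the same positive
  amount \<open>\<delta>\<close>, by scaling, and there are infinitely many disjoint shells.
  The shells are summed in the measure with density \<open>\<phi>\<close>, an explicit measurable minorant of \<open>h\<close>.
\<close>

lemma nn_integral_slow_decay_infinite:
  fixes h :: "'a::euclidean_space \<Rightarrow> ennreal"
  assumes c: "c > 0" and R: "R > 0"
    and lower: "\<And>y. norm y \<ge> R \<Longrightarrow> h y \<ge> ennreal (c * norm y powr (- real DIM('a)))"
  shows "(\<integral>\<^sup>+ y. h y \<partial>lborel) = \<infinity>"
proof (rule ccontr)
  define d where "d = DIM('a)"
  define A where "A k = ball (0::'a) (R * 2 ^ Suc k) - ball 0 (R * 2 ^ k)" for k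
  define \<phi> where "\<phi> y = ennreal (c * norm y powr (- real d)) * indicator {y. R \<le> norm y} y" for y :: 'a
  define \<delta> where "\<delta> = c * unit_ball_vol d * (1 - 1 / 2 ^ d)"
  have d: "d > 0" by (simp add: d_def)
  have "(1::real) < 2 ^ d" using d by simp
  then have \<delta>: "\<delta> > 0" using c by (simp add: \<delta>_def)
  have [measurable]: "\<phi> \<in> borel_measurable borel" unfolding \<phi>_def by measurable
  have A_meas: "A k \<in> sets (density lborel \<phi>)" for k by (simp add: A_def)
  have volA: "emeasure lborel (A k) = ennreal (unit_ball_vol d * (R * 2 ^ k) ^ d * (2 ^ d - 1))" for k
  proof -
    have "emeasure lborel (A k) = emeasure lborel (ball (0::'a) (R * 2 ^ Suc k)) - emeasure lborel (ball (0::'a) (R * 2 ^ k))"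
      unfolding A_def using R
      by (intro emeasure_Diff subset_ball mult_left_mono power_increasing) (auto simp: emeasure_ball)
    also have "\<dots> = ennreal (unit_ball_vol d * (R * 2 ^ Suc k) ^ d - unit_ball_vol d * (R * 2 ^ k) ^ d)"
      using R by (simp add: emeasure_ball d_def ennreal_minus)
    also have "unit_ball_vol d * (R * 2 ^ Suc k) ^ d - unit_ball_vol d * (R * 2 ^ k) ^ d
       = unit_ball_vol d * (R * 2 ^ k) ^ d * (2 ^ d - 1)"
      by (simp add: power_mult_distrib algebra_simps)
    finally show ?thesis .
  qed
  have shell: "ennreal \<delta> \<le> emeasure (density lborel \<phi>) (A k)" for k
  proof -
    \<comment> \<open>the value of the minorant on the outer boundary of the shell\<close>
    define \<kappa> where "\<kappa> = c * (R * 2 ^ Suc k) powr (- real d)"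
    have "ennreal \<kappa> * emeasure lborel (A k) = (\<integral>\<^sup>+ y. ennreal \<kappa> * indicator (A k) y \<partial>lborel)"
      by (subst nn_integral_cmult_indicator) (auto simp: A_def)
    also have "\<dots> \<le> (\<integral>\<^sup>+ y. \<phi> y * indicator (A k) y \<partial>lborel)"
    proof (intro nn_integral_mono)
      fix y :: 'a
      show "ennreal \<kappa> * indicator (A k) y \<le> \<phi> y * indicator (A k) y"
      proof (cases "y \<in> A k")
        case True
        then have y: "R * 2 ^ k \<le> norm y" "norm y < R * 2 ^ Suc k" by (auto simp: A_def)
        have "R * 1 \<le> R * 2 ^ k" using R by (intro mult_left_mono) auto
        then have Ry: "R \<le> norm y" using y by simp
        have "(R * 2 ^ Suc k) powr (- real d) \<le> norm y powr (- real d)"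
          using y Ry R by (intro powr_mono2') auto
        then have "\<kappa> \<le> c * norm y powr (- real d)" using c by (simp add: \<kappa>_def)
        then show ?thesis using True Ry by (simp add: \<phi>_def ennreal_leI)
      qed simp
    qed
    also have "\<dots> = emeasure (density lborel \<phi>) (A k)"
      by (rule emeasure_density[symmetric]) (auto simp: A_def)
    finally have "ennreal \<kappa> * emeasure lborel (A k) \<le> emeasure (density lborel \<phi>) (A k)" .
    moreover have "ennreal \<kappa> * emeasure lborel (A k) = ennreal (\<kappa> * (unit_ball_vol d * (R * 2 ^ k) ^ d * (2 ^ d - 1)))"
      unfolding volA using c by (intro ennreal_mult'[symmetric]) (simp add: \<kappa>_def)
    moreover have "\<kappa> * (unit_ball_vol d * (R * 2 ^ k) ^ d * (2 ^ d - 1)) = \<delta>"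
      using R by (simp add: \<kappa>_def \<delta>_def powr_minus_divide powr_realpow power_mult_distrib field_simps)
    ultimately show ?thesis by simp
  qed
  have disj: "disjoint_family A"
  proof -
    have "A i \<inter> A j = {}" if "i < j" for i j
    proof -
      have "R * 2 ^ Suc i \<le> R * 2 ^ j" using that R by (intro mult_left_mono power_increasing) auto
      then show ?thesis by (auto simp: A_def)
    qed
    then show ?thesis unfolding disjoint_family_on_def by (metis Int_commute nat_neq_iff)
  qed
  have total: "emeasure (density lborel \<phi>) UNIV \<le> (\<integral>\<^sup>+ y. h y \<partial>lborel)"
  proof -
    have "emeasure (density lborel \<phi>) UNIV = (\<integral>\<^sup>+ y. \<phi> y * indicator UNIV y \<partial>lborel)"
      by (rule emeasure_density) auto
    also have "\<dots> \<le> (\<integral>\<^sup>+ y. h y \<partial>lborel)"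
      using lower by (intro nn_integral_mono) (auto simp: \<phi>_def d_def indicator_def)
    finally show ?thesis .
  qed
  have many: "ennreal (real N * \<delta>) \<le> (\<integral>\<^sup>+ y. h y \<partial>lborel)" for N
  proof -
    have "ennreal (real N * \<delta>) = (\<Sum>k<N. ennreal \<delta>)"
      using \<delta> by (simp add: ennreal_mult' ennreal_of_nat_eq_real_of_nat)
    also have "\<dots> \<le> (\<Sum>k<N. emeasure (density lborel \<phi>) (A k))"
      by (intro sum_mono shell)
    also have "\<dots> = emeasure (density lborel \<phi>) (\<Union>k<N. A k)"
      using A_meas disj by (intro sum_emeasure) (auto simp: disjoint_family_on_def)
    also have "\<dots> \<le> emeasure (density lborel \<phi>) UNIV"
      by (rule emeasure_mono) auto
    finally show ?thesis using total by (rule order_trans)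
  qed
  assume "(\<integral>\<^sup>+ y. h y \<partial>lborel) \<noteq> \<infinity>"
  then obtain z where z: "z \<ge> 0" "(\<integral>\<^sup>+ y. h y \<partial>lborel) = ennreal z"
    by (cases "\<integral>\<^sup>+ y. h y \<partial>lborel") auto
  obtain N :: nat where "z < real N * \<delta>" using reals_Archimedean3[OF \<delta>] by blast
  then show False using many[of N] z by simp
qed

text \<open>
  In both regimes the bound holds at the critical speed itself. With \<open>q = sqrt d\<close> it reduces for \<open>l < d\<close>
  to \<open>q ((q - 1)\<^sup>2 + 1 + l) \<ge> 0\<close>, and otherwise, with \<open>p = sqrt l\<close>, to
  \<open>2 d (p - 1) + d + p\<^sup>2 + 2 \<ge> 0\<close>.
\<close>

lemma subcritical_speed_bound:
  fixes d l r :: real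
  assumes d: "d \<ge> 1" and l: "l > 0" and r: "r < r_circ d l"
  shows "(l + 2) * (r - 1) \<le> d"
proof (cases "l < d")
  case True
  define q where "q = sqrt d"
  have q: "q \<ge> 1" "d = q\<^sup>2" using d by (auto simp: q_def)
  have "r < (d + l) / (l + q)" using r True by (simp add: r_circ_def r_star_def q_def)
  then have "(r - 1) * (l + q) \<le> d - q" using q l by (simp add: field_simps)
  then have "(l + 2) * ((r - 1) * (l + q)) \<le> (l + 2) * (d - q)"
    using l by (intro mult_left_mono) auto
  also have "\<dots> \<le> d * (l + q)"
  proof -
    have "d * (l + q) - (l + 2) * (d - q) = q * ((q - 1)\<^sup>2 + 1 + l)"
      unfolding q(2) by (simp add: algebra_simps power2_eq_square)
    moreover have "0 \<le> q * ((q - 1)\<^sup>2 + 1 + l)" using q l by (intro mult_nonneg_nonneg) auto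
    ultimately show ?thesis by linarith
  qed
  finally have "((l + 2) * (r - 1)) * (l + q) \<le> d * (l + q)" by (simp add: mult.assoc)
  then show ?thesis using q l by (simp add: mult_le_cancel_right)
next
  case False
  define p where "p = sqrt l"
  have p: "p \<ge> 1" "l = p\<^sup>2" using False d l by (auto simp: p_def)
  have "r - 1 < (d - 1) / (1 + p)\<^sup>2" using r False by (simp add: r_circ_def r_plus_def p_def)
  then have "(r - 1) * (1 + p)\<^sup>2 \<le> d - 1" using p by (simp add: pos_less_divide_eq less_imp_le)
  then have "(l + 2) * ((r - 1) * (1 + p)\<^sup>2) \<le> (l + 2) * (d - 1)"
    using l by (intro mult_left_mono) auto
  also have "\<dots> \<le> d * (1 + p)\<^sup>2"
  proof -
    have "d * (1 + p)\<^sup>2 - (l + 2) * (d - 1) = 2 * d * (p - 1) + d + p\<^sup>2 + 2"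
      unfolding p(2) by (simp add: algebra_simps power2_eq_square)
    moreover have "0 \<le> 2 * d * (p - 1)" using p d by simp
    ultimately show ?thesis using d zero_le_power2[of p] by linarith
  qed
  finally have "((l + 2) * (r - 1)) * (1 + p)\<^sup>2 \<le> d * (1 + p)\<^sup>2" by (simp add: mult.assoc)
  moreover have "(1 + p)\<^sup>2 > 0" using p by simp
  ultimately show ?thesis by (simp only: mult_le_cancel_right_pos)
qed

section \<open>The flow generated by a profile\<close>

text \<open>
  The functions \<open>S\<close> and \<open>V\<close> of the far field are fixed together with the profile, because they enter
  the very definition of the flow at time \<open>T\<close>.
\<close>

locale selfsimilar_flow =
  fixes \<gamma> l r T b :: real and S V :: "real \<Rightarrow> real"
    and \<rho> :: "'a::euclidean_space \<Rightarrow> real" and u :: "'a \<Rightarrow> 'a"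
  assumes \<gamma>: "\<gamma> = 1 + 2 / l" and l: "l > 0" and r: "r > 1" and b: "b > 0"
    and smooth: "smooth_on UNIV \<rho>" "smooth_on UNIV u"
    and symm: "spherically_symmetric \<rho> u"
    and Ck_SV: "\<And>k. Ck_on k {0..b} S \<and> Ck_on k {0..b} V"
    and S_pos: "\<And>\<tau>. \<tau> \<ge> 0 \<Longrightarrow> S \<tau> > 0"
    and far_\<rho>: "\<And>Z. Z \<noteq> 0 \<Longrightarrow> \<rho> Z = (sqrt (l / 2) * norm Z powr (1 - r) * S (norm Z powr (- r))) powr l"
    and far_u: "\<And>Z. Z \<noteq> 0 \<Longrightarrow> u Z = - (norm Z powr (- r) * V (norm Z powr (- r))) *\<^sub>R Z"
begin

abbreviation Z :: "real \<times> 'a \<Rightarrow> 'a" where "Z \<equiv> selfsim_var r T r"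

definition \<tau> :: "real \<times> 'a \<Rightarrow> real" where
  "\<tau> p = r powr r * (T - fst p) * norm (snd p) powr (- r)"

definition K :: real where "K = sqrt (l / 2) * r powr (r - 1)"

text \<open>
  At \<open>t = T\<close> the self-similar formula degenerates, so the fields are continued there by their far-field
  form, in which \<open>T - t\<close> enters only through \<open>\<tau>\<close>. On the slice \<open>t = T\<close> one has \<open>\<tau> = 0\<close>.
\<close>

definition R :: "real \<times> 'a \<Rightarrow> real" where
  "R p = (if fst p < T
     then 1 / (T - fst p) powr (2 * (r - 1) / (r * (\<gamma> - 1))) * \<rho> (Z p)
     else (K * norm (snd p) powr (1 - r) * S (\<tau> p)) powr l)"

definition U :: "real \<times> 'a \<Rightarrow> 'a" where
  "U p = (if fst p < T
     then (1 / (T - fst p) powr ((r - 1) / r)) *\<^sub>R u (Z p)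
     else (- (r powr (r - 1) * norm (snd p) powr (- r) * V (\<tau> p))) *\<^sub>R snd p)"

lemma K_pos: "K > 0"
  using l r by (simp add: K_def)

lemma norm_Z: "t < T \<Longrightarrow> norm (Z (t, y)) = norm y / (r * (T - t) powr (1 / r))"
  using r by (simp add: selfsim_var_def)

lemma norm_Z_powr:
  assumes "t < T"
  shows "norm (Z (t, y)) powr a = norm y powr a * r powr (- a) * (T - t) powr (- a / r)"
  unfolding norm_Z[OF assms] using r assms
  by (simp add: powr_divide powr_mult powr_powr powr_minus_divide)

lemma norm_Z_eq_\<tau>: "t < T \<Longrightarrow> norm (Z (t, y)) powr (- r) = \<tau> (t, y)"
  using r by (simp add: norm_Z_powr \<tau>_def)

lemma Z_eq_0_iff: "t < T \<Longrightarrow> Z (t, y) = 0 \<longleftrightarrow> y = 0"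
  using r by (simp add: selfsim_var_def)

lemma \<tau>_nonneg: "fst p \<le> T \<Longrightarrow> \<tau> p \<ge> 0"
  by (simp add: \<tau>_def)

text \<open>
  All powers of \<open>T - t\<close> except the one in \<open>\<tau>\<close> cancel, so the continuation at \<open>t = T\<close> and the
  self-similar formula are instances of one expression away from \<open>y = 0\<close>.
\<close>

lemma R_far:
  assumes "snd p \<noteq> 0"
  shows "R p = (K * norm (snd p) powr (1 - r) * S (\<tau> p)) powr l"
proof (cases "fst p < T")
  case True
  obtain t y where p: "p = (t, y)" by (cases p)
  have t: "t < T" and y: "y \<noteq> 0" using True assms p by auto
  define s where "s = T - t"
  have s: "s > 0" using t by (simp add: s_def)
  have S: "S (\<tau> p) > 0" using S_pos \<tau>_nonneg t p by simp
  have e: "2 * (r - 1) / (r * (\<gamma> - 1)) = (r - 1) / r * l"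
    using l r by (simp add: \<gamma> field_simps)
  have "sqrt (l / 2) * norm (Z p) powr (1 - r) * S (\<tau> p) = (K * norm y powr (1 - r) * S (\<tau> p)) * s powr ((r - 1) / r)"
    unfolding p norm_Z_powr[OF t] K_def s_def by (simp add: mult_ac)
  moreover have "\<rho> (Z p) = (sqrt (l / 2) * norm (Z p) powr (1 - r) * S (\<tau> p)) powr l"
    using far_\<rho>[of "Z p"] Z_eq_0_iff[OF t] y norm_Z_eq_\<tau>[OF t] p by simp
  ultimately have "\<rho> (Z p) = ((K * norm y powr (1 - r) * S (\<tau> p)) * s powr ((r - 1) / r)) powr l"
    by (simp only:)
  then have "\<rho> (Z p) = (K * norm y powr (1 - r) * S (\<tau> p)) powr l * s powr ((r - 1) / r * l)"
    using S K_pos by (simp only: powr_mult powr_powr)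
  moreover have "R p = 1 / s powr ((r - 1) / r * l) * \<rho> (Z p)"
    unfolding R_def e[symmetric] using t by (simp add: p s_def)
  ultimately show ?thesis using s by (simp add: p)
qed (simp add: R_def)

lemma U_far:
  assumes "snd p \<noteq> 0"
  shows "U p = (- (r powr (r - 1) * norm (snd p) powr (- r) * V (\<tau> p))) *\<^sub>R snd p"
proof (cases "fst p < T")
  case True
  obtain t y where p: "p = (t, y)" by (cases p)
  have t: "t < T" and y: "y \<noteq> 0" using True assms p by auto
  define s where "s = T - t"
  have s: "s > 0" using t by (simp add: s_def)
  have "u (Z p) = - (norm (Z p) powr (- r) * V (\<tau> p)) *\<^sub>R Z p"
    using far_u[of "Z p"] Z_eq_0_iff[OF t] y norm_Z_eq_\<tau>[OF t] p by simp
  also have "\<dots> = - (norm y powr (- r) * r powr r * s * V (\<tau> p) * (1 / (r * s powr (1 / r)))) *\<^sub>R y"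
    unfolding p norm_Z_powr[OF t] using r s by (simp add: selfsim_var_def s_def)
  finally have u: "u (Z p) = - (norm y powr (- r) * r powr r * s * V (\<tau> p) * (1 / (r * s powr (1 / r)))) *\<^sub>R y" .
  have e: "s powr ((r - 1) / r) * s powr (1 / r) = s"
    using s r by (simp add: diff_divide_distrib flip: powr_add)
  have "U p = (1 / s powr ((r - 1) / r) * - (norm y powr (- r) * r powr r * s * V (\<tau> p) * (1 / (r * s powr (1 / r))))) *\<^sub>R y"
    unfolding U_def u using t by (simp add: p s_def)
  also have "1 / s powr ((r - 1) / r) * - (norm y powr (- r) * r powr r * s * V (\<tau> p) * (1 / (r * s powr (1 / r))))
      = - (norm y powr (- r) * r powr r * V (\<tau> p) / r) * (s / (s powr ((r - 1) / r) * s powr (1 / r)))"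
    by (simp add: mult_ac)
  also have "\<dots> = - (r powr (r - 1) * norm y powr (- r) * V (\<tau> p))"
    unfolding e using s r by (simp add: powr_diff)
  finally show ?thesis by (simp add: p)
qed (simp add: U_def)

text \<open>
  Before \<open>T\<close> the flow is a composition with the smooth profile. Near a point \<open>(T, y)\<close> with \<open>y \<noteq> 0\<close> one has
  \<open>\<tau> < b\<close>, so the far-field form applies with \<open>S\<close> and \<open>V\<close> smooth on \<open>[0, b]\<close>, where \<open>\<tau> = 0\<close> is
  reached exactly on the final slice. The two regions cover the domain and glue.
\<close>

lemma space_time_smooth:
  "smooth_on ({..T} \<times> UNIV - {(T, 0)}) R" "smooth_on ({..T} \<times> UNIV - {(T, 0)}) U"
proof -
  define D :: "(real \<times> 'a) set" where "D = {..T} \<times> UNIV - {(T, 0)}"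
  define A :: "(real \<times> 'a) set" where "A = {..<T} \<times> UNIV"
  define N :: "(real \<times> 'a) set" where
    "N = {p. snd p \<noteq> 0 \<and> r powr r * (T - fst p) < b * norm (snd p) powr r}"
  have openA: "open A" unfolding A_def by (intro open_Times) auto
  have openN: "open N"
    unfolding N_def
    by (intro open_Collect_conj open_Collect_neq open_Collect_less continuous_intros continuous_on_powr')
       (use r in auto)
  have AD: "A \<subseteq> D" by (auto simp: A_def D_def)
  have DAN: "D \<subseteq> A \<union> N"
    using b by (auto simp: A_def D_def N_def)
  have fst: "Ck_on k Q (fst :: real \<times> 'a \<Rightarrow> real)" and snd: "Ck_on k Q (snd :: real \<times> 'a \<Rightarrow> 'a)" for k Q
    by (intro Ck_on_bounded_linear bounded_linear_fst bounded_linear_snd)+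
  have time: "Ck_on k Q (\<lambda>p :: real \<times> 'a. T - fst p)" for k Q
    by (rule Ck_on_cong[OF Ck_on_add[OF Ck_on_const[of k Q T] Ck_on_mult[OF Ck_on_const[of k Q "-1"] fst]]]) simp
  have timeA: "Ck_on k A (\<lambda>p. 1 / (T - fst p) powr a)" for k a
    by (intro Ck_on_divide Ck_on_const Ck_on_powr time) (auto simp: A_def)
  have ZA: "Ck_on k A Z" for k
  proof (rule Ck_on_cong)
    show "Ck_on k A (\<lambda>p. (1 / r * (1 / (T - fst p) powr (1 / r))) *\<^sub>R snd p)"
      by (intro Ck_on_scaleR Ck_on_mult Ck_on_const timeA snd)
  qed (auto simp: selfsim_var_def)
  have \<tau>N: "\<tau> p \<in> {0..b}" "snd p \<noteq> 0" if "p \<in> D \<inter> N" for p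
  proof -
    have "r powr r * (T - fst p) < b * norm (snd p) powr r" "snd p \<noteq> 0" "fst p \<le> T"
      using that by (auto simp: D_def N_def)
    then show "\<tau> p \<in> {0..b}" "snd p \<noteq> 0"
      using \<tau>_nonneg[of p] by (auto simp: \<tau>_def powr_minus_divide pos_divide_le_eq)
  qed
  have normN: "Ck_on k (D \<inter> N) (\<lambda>p. norm (snd p) powr a)" for k a
    by (intro Ck_on_powr Ck_on_norm snd) (use \<tau>N in auto)
  have Ck_\<tau>: "Ck_on k (D \<inter> N) \<tau>" for k
    unfolding \<tau>_def[abs_def] by (intro Ck_on_mult Ck_on_const time normN)
  have SV: "Ck_on k (D \<inter> N) (\<lambda>p. S (\<tau> p))" "Ck_on k (D \<inter> N) (\<lambda>p. V (\<tau> p))" for k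
    by (rule Ck_on_compose[OF _ Ck_\<tau>, of k "{0..b}"]; use Ck_SV \<tau>N in blast)+
  have "Ck_on k D R" for k
  proof (rule Ck_on_glue[OF openA openN AD DAN])
    show "Ck_on k A R"
    proof (rule Ck_on_cong)
      show "Ck_on k A (\<lambda>p. 1 / (T - fst p) powr (2 * (r - 1) / (r * (\<gamma> - 1))) * \<rho> (Z p))"
        using smooth(1) by (intro Ck_on_mult timeA Ck_on_compose[OF _ ZA, of _ UNIV]) (auto simp: smooth_on_def)
    qed (auto simp: R_def A_def)
    show "Ck_on k (D \<inter> N) R"
    proof (rule Ck_on_cong)
      show "Ck_on k (D \<inter> N) (\<lambda>p. (K * norm (snd p) powr (1 - r) * S (\<tau> p)) powr l)"
        using \<tau>N K_pos S_pos by (intro Ck_on_powr Ck_on_mult Ck_on_const normN SV) auto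
    qed (use R_far \<tau>N in simp)
  qed
  then show "smooth_on ({..T} \<times> UNIV - {(T, 0)}) R" by (simp add: smooth_on_def D_def)
  have "Ck_on k D U" for k
  proof (rule Ck_on_glue[OF openA openN AD DAN])
    show "Ck_on k A U"
    proof (rule Ck_on_cong)
      show "Ck_on k A (\<lambda>p. (1 / (T - fst p) powr ((r - 1) / r)) *\<^sub>R u (Z p))"
        using smooth(2) by (intro Ck_on_scaleR timeA Ck_on_compose[OF _ ZA, of _ UNIV]) (auto simp: smooth_on_def)
    qed (auto simp: U_def A_def)
    show "Ck_on k (D \<inter> N) U"
    proof (rule Ck_on_cong)
      show "Ck_on k (D \<inter> N) (\<lambda>p. ((- (r powr (r - 1))) * norm (snd p) powr (- r) * V (\<tau> p)) *\<^sub>R snd p)"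
        by (intro Ck_on_scaleR Ck_on_mult Ck_on_const normN SV snd)
    qed (use U_far \<tau>N in simp)
  qed
  then show "smooth_on ({..T} \<times> UNIV - {(T, 0)}) U" by (simp add: smooth_on_def D_def)
qed

lemma far_profiles_tendsto:
  assumes "(f \<longlongrightarrow> 0) F" "\<forall>\<^sub>F x in F. f x \<ge> 0"
  shows "((\<lambda>x. S (f x)) \<longlongrightarrow> S 0) F" "((\<lambda>x. V (f x)) \<longlongrightarrow> V 0) F"
proof -
  have "continuous_on {0..b} S" "continuous_on {0..b} V" using Ck_SV[of 0] by auto
  moreover have "\<forall>\<^sub>F x in F. f x \<in> {0..b}"
    using assms(2) order_tendstoD(2)[OF assms(1) b] by eventually_elim auto
  ultimately show "((\<lambda>x. S (f x)) \<longlongrightarrow> S 0) F" "((\<lambda>x. V (f x)) \<longlongrightarrow> V 0) F"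
    using b by (auto intro!: continuous_on_tendsto_compose[OF _ assms(1)])
qed

lemma norm_powr_tendsto_0: "a < 0 \<Longrightarrow> ((\<lambda>y::'a. norm y powr a) \<longlongrightarrow> 0) at_infinity"
  by (rule tendsto_neg_powr[OF _ filterlim_norm_at_top])

lemma \<tau>_tendsto_0: "((\<lambda>y. \<tau> (t, y)) \<longlongrightarrow> 0) at_infinity"
  unfolding \<tau>_def using r by (auto intro!: tendsto_mult_right_zero norm_powr_tendsto_0)

text \<open>
  The error terms are functions of \<open>Z\<close> alone, since \<open>\<tau> = |Z| powr (- r)\<close>.
\<close>

lemma asymptotics:
  obtains \<rho>s us o1 o2 where "\<rho>s > 0"
    "(o1 \<longlongrightarrow> 0) (inf (filtercomap Z at_infinity) (principal ({..<T} \<times> UNIV)))"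
    "(o2 \<longlongrightarrow> 0) (inf (filtercomap Z at_infinity) (principal ({..<T} \<times> UNIV)))"
    "\<forall>t<T. \<forall>y. y \<noteq> 0 \<longrightarrow>
        R (t, y) = \<rho>s * (1 + o1 (t, y)) / norm y powr (2 * (r - 1) / (\<gamma> - 1)) \<and>
        U (t, y) \<bullet> (y /\<^sub>R norm y) = (us + o2 (t, y)) / norm y powr (r - 1)"
proof
  let ?F = "inf (filtercomap Z at_infinity) (principal ({..<T} \<times> UNIV))"
  define O1 where "O1 z = (S (norm z powr (- r)) / S 0) powr l - 1" for z :: 'a
  define O2 where "O2 z = - (r powr (r - 1)) * (V (norm z powr (- r)) - V 0)" for z :: 'a
  have S0: "S 0 > 0" by (rule S_pos) simp
  have lim: "((\<lambda>z::'a. norm z powr (- r)) \<longlongrightarrow> 0) at_infinity"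
    using r by (intro norm_powr_tendsto_0) simp
  note SV = far_profiles_tendsto[OF lim]
  have "(O1 \<longlongrightarrow> (S 0 / S 0) powr l - 1) at_infinity"
    unfolding O1_def[abs_def] using S0 by (intro tendsto_intros SV) auto
  then have O1: "(O1 \<longlongrightarrow> 0) at_infinity" using S0 by simp
  have "(O2 \<longlongrightarrow> - (r powr (r - 1)) * (V 0 - V 0)) at_infinity"
    unfolding O2_def[abs_def] by (intro tendsto_intros SV) auto
  then have O2: "(O2 \<longlongrightarrow> 0) at_infinity" by simp
  have F: "filterlim Z at_infinity ?F"
    by (rule filterlim_mono[OF filterlim_filtercomap]) auto
  show "((O1 \<circ> Z) \<longlongrightarrow> 0) ?F" "((O2 \<circ> Z) \<longlongrightarrow> 0) ?F"
    using filterlim_compose[OF O1 F] filterlim_compose[OF O2 F] by (auto simp: o_def)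
  show "(K * S 0) powr l > 0" using K_pos S0 by simp
  show "\<forall>t<T. \<forall>y. y \<noteq> 0 \<longrightarrow>
        R (t, y) = (K * S 0) powr l * (1 + (O1 \<circ> Z) (t, y)) / norm y powr (2 * (r - 1) / (\<gamma> - 1)) \<and>
        U (t, y) \<bullet> (y /\<^sub>R norm y) = (- (r powr (r - 1)) * V 0 + (O2 \<circ> Z) (t, y)) / norm y powr (r - 1)"
  proof (intro allI impI conjI)
    fix t and y :: 'a assume t: "t < T" and y: "y \<noteq> 0"
    have S: "S (\<tau> (t, y)) > 0" using S_pos \<tau>_nonneg t by simp
    have e: "2 * (r - 1) / (\<gamma> - 1) = (r - 1) * l" using l by (simp add: \<gamma>)
    have ny: "norm y powr (1 - r) = 1 / norm y powr (r - 1)"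
      using powr_minus_divide[of "norm y" "r - 1"] by simp
    have "K * norm y powr (1 - r) * S (\<tau> (t, y)) = (K * S 0) * (S (\<tau> (t, y)) / S 0) / norm y powr (r - 1)"
      unfolding ny using S0 by simp
    then have "R (t, y) = (K * S 0) powr l * (S (\<tau> (t, y)) / S 0) powr l / norm y powr ((r - 1) * l)"
      using R_far[of "(t, y)"] y S S0 K_pos by (simp add: powr_mult powr_divide powr_powr)
    then show "R (t, y) = (K * S 0) powr l * (1 + (O1 \<circ> Z) (t, y)) / norm y powr (2 * (r - 1) / (\<gamma> - 1))"
      unfolding e by (simp add: O1_def norm_Z_eq_\<tau>[OF t])
    have "U (t, y) \<bullet> (y /\<^sub>R norm y) = - (r powr (r - 1) * norm y powr (- r) * V (\<tau> (t, y))) * norm y"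
      using U_far[of "(t, y)"] y by (simp add: dot_square_norm power2_eq_square)
    also have "\<dots> = - (r powr (r - 1) * V (\<tau> (t, y))) / norm y powr (r - 1)"
      using y by (simp add: powr_minus powr_diff field_simps)
    finally show "U (t, y) \<bullet> (y /\<^sub>R norm y) = (- (r powr (r - 1)) * V 0 + (O2 \<circ> Z) (t, y)) / norm y powr (r - 1)"
      by (simp add: O2_def norm_Z_eq_\<tau>[OF t] algebra_simps)
  qed
qed

lemma decay:
  assumes t: "t < T"
  shows "((\<lambda>y. R (t, y)) \<longlongrightarrow> 0) at_infinity" "((\<lambda>y. U (t, y)) \<longlongrightarrow> 0) at_infinity"
proof -
  have nonzero: "\<forall>\<^sub>F y::'a in at_infinity. y \<noteq> 0"
    unfolding eventually_at_infinity by (intro exI[of _ 1]) auto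
  have "\<forall>\<^sub>F y in at_infinity. \<tau> (t, y) \<ge> 0" using t \<tau>_nonneg by simp
  note SV = far_profiles_tendsto[OF \<tau>_tendsto_0 this]
  have lim: "((\<lambda>y::'a. norm y powr (1 - r)) \<longlongrightarrow> 0) at_infinity"
    using r by (intro norm_powr_tendsto_0) simp
  have "((\<lambda>y. K * norm y powr (1 - r) * S (\<tau> (t, y))) \<longlongrightarrow> K * 0 * S 0) at_infinity"
    by (intro tendsto_intros lim SV)
  moreover have "\<forall>\<^sub>F y in at_infinity. 0 \<le> K * norm y powr (1 - r) * S (\<tau> (t, y))"
    using K_pos S_pos[OF \<tau>_nonneg] t by (simp add: less_imp_le)
  ultimately have "((\<lambda>y. (K * norm y powr (1 - r) * S (\<tau> (t, y))) powr l) \<longlongrightarrow> (K * 0 * S 0) powr l) at_infinity"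
    using l by (intro tendsto_powr' tendsto_const) auto
  then have "((\<lambda>y. (K * norm y powr (1 - r) * S (\<tau> (t, y))) powr l) \<longlongrightarrow> 0) at_infinity"
    by simp
  then show "((\<lambda>y. R (t, y)) \<longlongrightarrow> 0) at_infinity"
    by (rule Lim_transform_eventually) (use nonzero in eventually_elim, simp add: R_far)
  have "((\<lambda>y. r powr (r - 1) * norm y powr (1 - r) * \<bar>V (\<tau> (t, y))\<bar>) \<longlongrightarrow> r powr (r - 1) * 0 * \<bar>V 0\<bar>) at_infinity"
    by (intro tendsto_intros lim SV)
  then have "((\<lambda>y. r powr (r - 1) * norm y powr (1 - r) * \<bar>V (\<tau> (t, y))\<bar>) \<longlongrightarrow> 0) at_infinity"
    by simp
  moreover have "\<forall>\<^sub>F y in at_infinity. r powr (r - 1) * norm y powr (1 - r) * \<bar>V (\<tau> (t, y))\<bar> = norm (U (t, y))"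
    using nonzero by eventually_elim (simp add: U_far powr_minus powr_diff abs_mult field_simps)
  ultimately have "((\<lambda>y. norm (U (t, y))) \<longlongrightarrow> 0) at_infinity"
    by (rule Lim_transform_eventually)
  then show "((\<lambda>y. U (t, y)) \<longlongrightarrow> 0) at_infinity"
    by (rule tendsto_norm_zero_cancel)
qed

text \<open>
  The internal energy alone diverges: \<open>R powr \<gamma>\<close> is bounded below by a multiple of
  \<open>|y| powr ((1 - r) (l + 2))\<close>, as \<open>l \<gamma> = l + 2\<close>.
\<close>

lemma infinite_energy:
  assumes t: "t < T" and speed: "(l + 2) * (r - 1) \<le> real DIM('a)"
  shows "energy \<gamma> (\<lambda>y. R (t, y)) (\<lambda>y. U (t, y)) = \<infinity>"
proof -
  have S0: "S 0 > 0" by (rule S_pos) simp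
  have \<gamma>0: "\<gamma> > 0" using l by (simp add: \<gamma> add_pos_pos)
  have \<gamma>l: "l * \<gamma> = l + 2" using l by (simp add: \<gamma> field_simps)
  have "\<forall>\<^sub>F y in at_infinity. \<tau> (t, y) \<ge> 0" using t \<tau>_nonneg by simp
  from order_tendstoD(1)[OF far_profiles_tendsto(1)[OF \<tau>_tendsto_0 this], of "S 0 / 2"] S0
  obtain B where B: "\<And>y. norm y \<ge> B \<Longrightarrow> S 0 / 2 < S (\<tau> (t, y))"
    unfolding eventually_at_infinity by auto
  define c where "c = 1 / \<gamma> * (K * (S 0 / 2)) powr (l + 2)"
  show ?thesis
    unfolding energy_def
  proof (rule nn_integral_slow_decay_infinite[of c "max 1 B"])
    show "c > 0" using \<gamma>0 K_pos S0 by (simp add: c_def)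
    fix y :: 'a assume "max 1 B \<le> norm y"
    then have y: "norm y \<ge> 1" "norm y \<ge> B" "y \<noteq> 0" by auto
    have Sy: "S (\<tau> (t, y)) > 0" using S_pos \<tau>_nonneg t by simp
    have "norm y powr (- real DIM('a)) \<le> norm y powr ((1 - r) * (l + 2))"
      using y(1) speed by (intro powr_mono) (auto simp: algebra_simps)
    then have "c * norm y powr (- real DIM('a)) \<le> c * norm y powr ((1 - r) * (l + 2))"
      using \<gamma>0 K_pos S0 by (intro mult_left_mono) (auto simp: c_def)
    also have "\<dots> = 1 / \<gamma> * (K * norm y powr (1 - r) * (S 0 / 2)) powr (l + 2)"
      using K_pos S0 by (simp add: c_def powr_mult powr_divide powr_powr)
    also have "\<dots> \<le> 1 / \<gamma> * (K * norm y powr (1 - r) * S (\<tau> (t, y))) powr (l + 2)"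
      using \<gamma>0 K_pos S0 l B[OF y(2)] by (intro mult_left_mono powr_mono2) auto
    also have "\<dots> = 1 / \<gamma> * R (t, y) powr \<gamma>"
      using R_far[of "(t, y)"] y(3) by (simp add: powr_powr \<gamma>l)
    also have "\<dots> \<le> 1 / 2 * R (t, y) * (norm (U (t, y)))\<^sup>2 + 1 / \<gamma> * R (t, y) powr \<gamma>"
      using R_far[of "(t, y)"] y(3) by simp
    finally show "ennreal (c * norm y powr (- real DIM('a))) \<le>
        ennreal (1 / 2 * R (t, y) * (norm (U (t, y)))\<^sup>2 + 1 / \<gamma> * R (t, y) powr \<gamma>)"
      by (rule ennreal_leI)
  qed simp
qed

lemma symmetric:
  assumes t: "t < T"
  shows "spherically_symmetric (\<lambda>y. R (t, y)) (\<lambda>y. U (t, y))"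
proof -
  obtain f g where f: "\<And>z. \<rho> z = f (norm z)" and g: "\<And>z. u z = g (norm z) *\<^sub>R z"
    using symm unfolding spherically_symmetric_def by blast
  define c where "c = 1 / (r * (T - t) powr (1 / r))"
  have c: "c \<ge> 0" using r by (simp add: c_def)
  have Z: "Z (t, y) = c *\<^sub>R y" for y by (simp add: selfsim_var_def c_def)
  have "\<forall>y. R (t, y) = 1 / (T - t) powr (2 * (r - 1) / (r * (\<gamma> - 1))) * f (c * norm y)"
    using t c by (simp add: R_def f Z)
  moreover have "\<forall>y. U (t, y) = (1 / (T - t) powr ((r - 1) / r) * g (c * norm y) * c) *\<^sub>R y"
    using t c by (simp add: U_def g Z)
  ultimately show ?thesis
    unfolding spherically_symmetric_def
    by (intro conjI exI[of _ "\<lambda>s. 1 / (T - t) powr (2 * (r - 1) / (r * (\<gamma> - 1))) * f (c * s)"]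
        exI[of _ "\<lambda>s. 1 / (T - t) powr ((r - 1) / r) * g (c * s) * c"])
qed

end

section \<open>Self-similar solutions of the Euler equations\<close>

theorem corollary1p3:
  fixes l \<gamma> :: real
    and r :: "nat \<Rightarrow> real"
    and \<rho>hat :: "nat \<Rightarrow> real ^ 'n \<Rightarrow> real"
    and uhat :: "nat \<Rightarrow> real ^ 'n \<Rightarrow> real ^ 'n"
  assumes "CARD('n) \<ge> 2"
    and "l \<in> O_set (real CARD('n))"
    and "S_inf (real CARD('n)) l \<noteq> 0"
    and "\<gamma> = 1 + 2 / l"
    and "\<And>n. 1 < r n"
    and "\<And>n. r n < r_circ (real CARD('n)) l"
    and "r \<longlonglongrightarrow> r_circ (real CARD('n)) l"
    and "\<And>n. global_smooth_profile \<gamma> l (r n) (\<rho>hat n) (uhat n)"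
  shows "\<forall>n. \<forall>T::real. \<exists>lam0>0. \<exists>(\<rho> :: real \<times> (real ^ 'n) \<Rightarrow> real) (u :: real \<times> (real ^ 'n) \<Rightarrow> real ^ 'n).
    euler_solution \<gamma> T \<rho> u \<and>
    smooth_on ({..T} \<times> UNIV - {(T, 0)}) \<rho> \<and>
    smooth_on ({..T} \<times> UNIV - {(T, 0)}) u \<and>
    (\<forall>t<T. spherically_symmetric (\<lambda>y. \<rho> (t, y)) (\<lambda>y. u (t, y))) \<and>
    (\<forall>t<T. \<forall>y.
      \<rho> (t, y) = 1 / (T - t) powr (2 * (r n - 1) / (r n * (\<gamma> - 1)))
                   * \<rho>hat n (selfsim_var lam0 T (r n) (t, y)) \<and>
      u (t, y) = (1 / (T - t) powr ((r n - 1) / r n))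
                   *\<^sub>R uhat n (selfsim_var lam0 T (r n) (t, y))) \<and>
    (\<exists>\<rho>s>0. \<exists>us. \<exists>o1 o2.
      (o1 \<longlongrightarrow> 0) (inf (filtercomap (selfsim_var lam0 T (r n)) at_infinity) (principal ({..<T} \<times> UNIV))) \<and>
      (o2 \<longlongrightarrow> 0) (inf (filtercomap (selfsim_var lam0 T (r n)) at_infinity) (principal ({..<T} \<times> UNIV))) \<and>
      (\<forall>t<T. \<forall>y. y \<noteq> 0 \<longrightarrow>
        \<rho> (t, y) = \<rho>s * (1 + o1 (t, y)) / norm y powr (2 * (r n - 1) / (\<gamma> - 1)) \<and>
        u (t, y) \<bullet> (y /\<^sub>R norm y) = (us + o2 (t, y)) / norm y powr (r n - 1))) \<and>
    (\<forall>t<T. ((\<lambda>y. \<rho> (t, y)) \<longlongrightarrow> 0) at_infinity \<and> ((\<lambda>y. u (t, y)) \<longlongrightarrow> 0) at_infinity) \<and>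
    (\<forall>t<T. energy \<gamma> (\<lambda>y. \<rho> (t, y)) (\<lambda>y. u (t, y)) = \<infinity>)"
proof (intro allI)
  fix n and T :: real
  define d where "d = real CARD('n)"
  have d: "d \<ge> 1" using assms(1) by (simp add: d_def)
  have l: "l > 0" using assms(2) d by (auto simp: O_set_def d_def)
  have r: "r n > 1" by (rule assms(5))
  note prof = assms(8)[of n]
  have smooth: "smooth_on UNIV (\<rho>hat n)" "smooth_on UNIV (uhat n)" and pos: "\<And>Z. \<rho>hat n Z > 0"
    and symm: "spherically_symmetric (\<rho>hat n) (uhat n)" and eq: "stationary_euler \<gamma> l (r n) (\<rho>hat n) (uhat n)"
    using prof unfolding global_smooth_profile_def by auto
  obtain b S V where far: "b > 0" "\<forall>k. Ck_on k {0..b} S \<and> Ck_on k {0..b} V" "\<forall>\<tau>\<ge>0. S \<tau> > 0"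
    "\<forall>Z. Z \<noteq> 0 \<longrightarrow> \<rho>hat n Z = (sqrt (l / 2) * norm Z powr (1 - r n) * S (norm Z powr (- r n))) powr l"
    "\<forall>Z. Z \<noteq> 0 \<longrightarrow> uhat n Z = - (norm Z powr (- r n) * V (norm Z powr (- r n))) *\<^sub>R Z"
    by (rule global_profile_far_field[OF prof assms(4) l]) (use r in simp)
  interpret selfsimilar_flow \<gamma> l "r n" T b S V "\<rho>hat n" "uhat n"
    using assms(4) l r smooth symm far by unfold_locales auto
  have euler: "euler_solution \<gamma> T R U"
    using r smooth[THEN smooth_on_UNIV_differentiable]
    by (intro selfsimilar_euler_solution[OF eq assms(4) l _ _ _ pos]) (auto simp: R_def U_def)
  have speed: "(l + 2) * (r n - 1) \<le> real DIM(real ^ 'n)"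
    using subcritical_speed_bound[OF d l, of "r n"] assms(6)[of n] by (simp add: d_def)
  have asym: "\<exists>\<rho>s>0. \<exists>us. \<exists>o1 o2.
      (o1 \<longlongrightarrow> 0) (inf (filtercomap (selfsim_var (r n) T (r n)) at_infinity) (principal ({..<T} \<times> UNIV))) \<and>
      (o2 \<longlongrightarrow> 0) (inf (filtercomap (selfsim_var (r n) T (r n)) at_infinity) (principal ({..<T} \<times> UNIV))) \<and>
      (\<forall>t<T. \<forall>y. y \<noteq> 0 \<longrightarrow>
        R (t, y) = \<rho>s * (1 + o1 (t, y)) / norm y powr (2 * (r n - 1) / (\<gamma> - 1)) \<and>
        U (t, y) \<bullet> (y /\<^sub>R norm y) = (us + o2 (t, y)) / norm y powr (r n - 1))"
    by (rule asymptotics) blast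
  have scaling: "\<forall>t<T. \<forall>y. R (t, y) = 1 / (T - t) powr (2 * (r n - 1) / (r n * (\<gamma> - 1)))
                   * \<rho>hat n (selfsim_var (r n) T (r n) (t, y)) \<and>
      U (t, y) = (1 / (T - t) powr ((r n - 1) / r n)) *\<^sub>R uhat n (selfsim_var (r n) T (r n) (t, y))"
    by (simp add: R_def U_def)
  show "\<exists>lam0>0. \<exists>(\<rho> :: real \<times> (real ^ 'n) \<Rightarrow> real) (u :: real \<times> (real ^ 'n) \<Rightarrow> real ^ 'n).
    euler_solution \<gamma> T \<rho> u \<and>
    smooth_on ({..T} \<times> UNIV - {(T, 0)}) \<rho> \<and>
    smooth_on ({..T} \<times> UNIV - {(T, 0)}) u \<and>
    (\<forall>t<T. spherically_symmetric (\<lambda>y. \<rho> (t, y)) (\<lambda>y. u (t, y))) \<and>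
    (\<forall>t<T. \<forall>y.
      \<rho> (t, y) = 1 / (T - t) powr (2 * (r n - 1) / (r n * (\<gamma> - 1)))
                   * \<rho>hat n (selfsim_var lam0 T (r n) (t, y)) \<and>
      u (t, y) = (1 / (T - t) powr ((r n - 1) / r n))
                   *\<^sub>R uhat n (selfsim_var lam0 T (r n) (t, y))) \<and>
    (\<exists>\<rho>s>0. \<exists>us. \<exists>o1 o2.
      (o1 \<longlongrightarrow> 0) (inf (filtercomap (selfsim_var lam0 T (r n)) at_infinity) (principal ({..<T} \<times> UNIV))) \<and>
      (o2 \<longlongrightarrow> 0) (inf (filtercomap (selfsim_var lam0 T (r n)) at_infinity) (principal ({..<T} \<times> UNIV))) \<and>
      (\<forall>t<T. \<forall>y. y \<noteq> 0 \<longrightarrow>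
        \<rho> (t, y) = \<rho>s * (1 + o1 (t, y)) / norm y powr (2 * (r n - 1) / (\<gamma> - 1)) \<and>
        u (t, y) \<bullet> (y /\<^sub>R norm y) = (us + o2 (t, y)) / norm y powr (r n - 1))) \<and>
    (\<forall>t<T. ((\<lambda>y. \<rho> (t, y)) \<longlongrightarrow> 0) at_infinity \<and> ((\<lambda>y. u (t, y)) \<longlongrightarrow> 0) at_infinity) \<and>
    (\<forall>t<T. energy \<gamma> (\<lambda>y. \<rho> (t, y)) (\<lambda>y. u (t, y)) = \<infinity>)"
    by (rule exI[of _ "r n"], rule conjI, use r in simp, rule exI[of _ R], rule exI[of _ U],
        intro conjI euler space_time_smooth scaling asym allI impI symmetric decay infinite_energy[OF _ speed])
qed

end
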